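(* The $n$-dimensional noisy linear system $X_{t+1}=AX_t+BU_t+W_t$ can be mean square stabilized over a scalar Gaussian channel having information capacity $\mathcal C$, if $$\log\left(|\det(A)|\right)<\mathcal C.$$ Furthermore, a linear time varying policy is sufficient, through sequential linear encoding of scalar components.
   Context: Notation: $\mathbb N=\{0,1,2,\dots\}$, $X_{[0,t]}=(X_0,\dots,X_t)$, $\log$ is base 2. Plant: $X_{t+1}=AX_t+BU_t+W_t$, $t\in\mathbb N$, with state $X_t\in\mathbb R^n$, control $U_t\in\mathbb R^m$, plant noise $W_t\in\mathbb R^n$. The initial state $X_0$ is a random vector with finite differential entropy and a given covariance matrix $\Lambda_0$. $\{W_t\}$ is a zero-mean white Gaussian sequence with covariance $K_W$, independent of $X_0$. The pair $(A,B)$ is controllable and all eigenvalues $\lambda_i$ of $A$ satisfy $|\lambda_i|\ge 1$. The system is mean square stabilized if there is a constant $M<\infty$ with $\mathbb E[\|X_t\|^2]<M$ for all $t$. Scalar Gaussian channel: at each time the encoder sends $S_t=f_t(X_{[0,t]},U_{[0,t-1]})\in\mathbb R$ with average transmit power $P$, the controller receives $R_t=S_t+Z_t$, where $\{Z_t\}$ is white zero-mean Gaussian noise of variance $N$, independent of $X_0$ and $\{W_t\}$, and applies $U_t=\pi_t(R_{[0,t]})$. The information capacity is $\mathcal C:=\frac12\log\left(1+\frac PN\right)$. A linear time varying policy is one in which $f_t$ and $\pi_t$ are linear functions of their arguments which may depend on $t$; sequential linear encoding of scalar components means that at each time the encoder transmits, linearly, only one scalar component of an observed state vector (the state may first be transformed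 by a similarity transformation). *)

theory Defs
  imports "HOL-Probability.Probability"
begin

section \<open>Linear plants\<close>

(* The span of the columns of B, AB, ..., A^(n-1)B is the column space of the Kalman
   controllability matrix, so this says that this matrix has rank n. *)
definition controllable :: "real^'n^'n \<Rightarrow> real^'m^'n \<Rightarrow> bool" where
  "controllable A B \<longleftrightarrow>
     span {(((*v) A) ^^ k) (column j B) | k j. k < CARD('n)} = UNIV"

definition eigenvalue :: "real^'n^'n \<Rightarrow> complex \<Rightarrow> bool" where
  "eigenvalue A \<mu> \<longleftrightarrow> (\<exists>v. v \<noteq> 0 \<and> map_matrix complex_of_real A *v v = \<mu> *s v)"

section \<open>Random data\<close>

definition has_covariance :: "'w measure \<Rightarrow> ('w \<Rightarrow> real^'n) \<Rightarrow> real^'n^'n \<Rightarrow> bool" where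
  "has_covariance M Y \<Lambda> \<longleftrightarrow>
     Y \<in> borel_measurable M \<and> integrable M (\<lambda>\<omega>. (norm (Y \<omega>))\<^sup>2) \<and>
     (\<forall>i j. (LINT \<omega>|M. (Y \<omega> $ i - (LINT \<omega>'|M. Y \<omega>' $ i)) * (Y \<omega> $ j - (LINT \<omega>'|M. Y \<omega>' $ j)))
              = \<Lambda> $ i $ j)"

definition finite_differential_entropy :: "'w measure \<Rightarrow> ('w \<Rightarrow> real^'n) \<Rightarrow> bool" where
  "finite_differential_entropy M Y \<longleftrightarrow>
     (\<exists>p. information_space.finite_entropy M 2 lborel Y p)"

(* Every linear functional is a zero-mean normal variable of variance v \<bullet> K v. The matrix K may
   be singular, in which case some of these normal variables degenerate to the constant 0. *)
definition zero_mean_gaussian :: "'w measure \<Rightarrow> ('w \<Rightarrow> real^'n) \<Rightarrow> real^'n^'n \<Rightarrow> bool" where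
  "zero_mean_gaussian M Y K \<longleftrightarrow>
     Y \<in> borel_measurable M \<and> transpose K = K \<and> (\<forall>v. 0 \<le> v \<bullet> (K *v v)) \<and>
     (\<forall>v. if v \<bullet> (K *v v) = 0 then (AE \<omega> in M. v \<bullet> Y \<omega> = 0)
          else distributed M lborel (\<lambda>\<omega>. v \<bullet> Y \<omega>) (normal_density 0 (sqrt (v \<bullet> (K *v v)))))"

definition white_gaussian_vectors ::
  "'w measure \<Rightarrow> (nat \<Rightarrow> 'w \<Rightarrow> real^'n) \<Rightarrow> real^'n^'n \<Rightarrow> bool" where
  "white_gaussian_vectors M W K \<longleftrightarrow>
     prob_space.indep_vars M (\<lambda>_. borel) W UNIV \<and> (\<forall>t. zero_mean_gaussian M (W t) K)"

definition white_gaussian_scalars ::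
  "'w measure \<Rightarrow> (nat \<Rightarrow> 'w \<Rightarrow> real) \<Rightarrow> real \<Rightarrow> bool" where
  "white_gaussian_scalars M Z N \<longleftrightarrow>
     prob_space.indep_vars M (\<lambda>_. borel) Z UNIV \<and>
     (\<forall>t. distributed M lborel (Z t) (normal_density 0 (sqrt N)))"

(* Same content as the library constant indep_var, which forces X and Y to have the same
   value type. *)
definition independent_vars ::
  "'w measure \<Rightarrow> 'a measure \<Rightarrow> ('w \<Rightarrow> 'a) \<Rightarrow> 'b measure \<Rightarrow> ('w \<Rightarrow> 'b) \<Rightarrow> bool" where
  "independent_vars M MX X MY Y \<longleftrightarrow>
     X \<in> measurable M MX \<and> Y \<in> measurable M MY \<and>
     prob_space.indep_set M {X -` E \<inter> space M | E. E \<in> sets MX}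
                            {Y -` E \<inter> space M | E. E \<in> sets MY}"

definition information_capacity :: "real \<Rightarrow> real \<Rightarrow> real" where
  "information_capacity P N = 1/2 * log 2 (1 + P / N)"

section \<open>Policies and the closed loop\<close>

(* An encoder f maps (X_0..X_t, U_0..U_(t-1)) to S_t, a controller g maps (R_0..R_t) to U_t.
   Histories are elements of product spaces, that is, extensional functions on {..t}
   or {..<t}. *)
type_synonym ('n, 'm) encoder = "nat \<Rightarrow> (nat \<Rightarrow> real^'n) \<Rightarrow> (nat \<Rightarrow> real^'m) \<Rightarrow> real"
type_synonym 'm controller = "nat \<Rightarrow> (nat \<Rightarrow> real) \<Rightarrow> real^'m"

definition measurable_policy :: "('n::finite, 'm::finite) encoder \<Rightarrow> 'm controller \<Rightarrow> bool" where
  "measurable_policy f g \<longleftrightarrow>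
     (\<forall>t. case_prod (f t) \<in>
            borel_measurable ((\<Pi>\<^sub>M s\<in>{..t}. borel) \<Otimes>\<^sub>M (\<Pi>\<^sub>M s\<in>{..<t}. borel))) \<and>
     (\<forall>t. g t \<in> borel_measurable (\<Pi>\<^sub>M s\<in>{..t}. borel))"

(* For given f, g and noise sequences, these equations determine X, U, S and R uniquely. *)
definition closed_loop ::
  "'w measure \<Rightarrow> real^'n^'n \<Rightarrow> real^'m^'n \<Rightarrow> ('w \<Rightarrow> real^'n) \<Rightarrow> (nat \<Rightarrow> 'w \<Rightarrow> real^'n) \<Rightarrow>
   (nat \<Rightarrow> 'w \<Rightarrow> real) \<Rightarrow> ('n, 'm) encoder \<Rightarrow> 'm controller \<Rightarrow>
   (nat \<Rightarrow> 'w \<Rightarrow> real^'n) \<Rightarrow> (nat \<Rightarrow> 'w \<Rightarrow> real^'m) \<Rightarrow>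
   (nat \<Rightarrow> 'w \<Rightarrow> real) \<Rightarrow> (nat \<Rightarrow> 'w \<Rightarrow> real) \<Rightarrow> bool" where
  "closed_loop M A B X0 W Z f g X U S R \<longleftrightarrow>
     (\<forall>\<omega>\<in>space M.
        X 0 \<omega> = X0 \<omega> \<and>
        (\<forall>t. S t \<omega> = f t (\<lambda>s\<in>{..t}. X s \<omega>) (\<lambda>s\<in>{..<t}. U s \<omega>) \<and>
             R t \<omega> = S t \<omega> + Z t \<omega> \<and>
             U t \<omega> = g t (\<lambda>s\<in>{..t}. R s \<omega>) \<and>
             X (Suc t) \<omega> = A *v X t \<omega> + B *v U t \<omega> + W t \<omega>))"

definition average_transmit_power ::
  "'w measure \<Rightarrow> (nat \<Rightarrow> 'w \<Rightarrow> real) \<Rightarrow> real \<Rightarrow> bool" where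
  "average_transmit_power M S P \<longleftrightarrow>
     (\<forall>t. integrable M (\<lambda>\<omega>. (S t \<omega>)\<^sup>2)) \<and>
     (\<lambda>T. (\<Sum>t<T. LINT \<omega>|M. (S t \<omega>)\<^sup>2) / real T) \<longlonglongrightarrow> P"

(* Integrability is required because the Bochner integral of a non-integrable function is 0. *)
definition mean_square_stable :: "'w measure \<Rightarrow> (nat \<Rightarrow> 'w \<Rightarrow> real^'n) \<Rightarrow> bool" where
  "mean_square_stable M X \<longleftrightarrow>
     (\<exists>C. \<forall>t. integrable M (\<lambda>\<omega>. (norm (X t \<omega>))\<^sup>2) \<and> (LINT \<omega>|M. (norm (X t \<omega>))\<^sup>2) < C)"

definition mean_square_stabilizes ::
  "'w measure \<Rightarrow> real^'n^'n \<Rightarrow> real^'m^'n \<Rightarrow> ('w \<Rightarrow> real^'n) \<Rightarrow> (nat \<Rightarrow> 'w \<Rightarrow> real^'n) \<Rightarrow>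
   (nat \<Rightarrow> 'w \<Rightarrow> real) \<Rightarrow> real \<Rightarrow> ('n, 'm) encoder \<Rightarrow> 'm controller \<Rightarrow> bool" where
  "mean_square_stabilizes M A B X0 W Z P f g \<longleftrightarrow>
     measurable_policy f g \<and>
     (\<exists>X U S R. closed_loop M A B X0 W Z f g X U S R \<and>
        average_transmit_power M S P \<and> mean_square_stable M X)"

definition linear_policy :: "('n::finite, 'm::finite) encoder \<Rightarrow> 'm controller \<Rightarrow> bool" where
  "linear_policy f g \<longleftrightarrow>
     (\<forall>t. \<exists>a b. \<forall>x u. f t x u = (\<Sum>s\<le>t. a s \<bullet> x s) + (\<Sum>s<t. b s \<bullet> u s)) \<and>
     (\<forall>t. \<exists>h. \<forall>r. g t r = (\<Sum>s\<le>t. r s *\<^sub>R h s))"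

(* T is the similarity transformation. At time t the states enter the transmitted signal only
   through the single component i of the transformed observed state T X_s, s \<le> t; the signal is
   that component, less a linear function of the past controls, scaled by the gain c. The
   correction by past controls lets the encoder retransmit what the controller does not yet know
   about the component. *)
definition sequential_scalar_encoding :: "('n::finite, 'm::finite) encoder \<Rightarrow> bool" where
  "sequential_scalar_encoding f \<longleftrightarrow>
     (\<exists>T :: real^'n^'n. invertible T \<and>
        (\<forall>t. \<exists>s\<le>t. \<exists>i c d. \<forall>x u. f t x u = c * ((T *v x s) $ i - (\<Sum>r<t. d r \<bullet> u r))))"

end

theory Submission
  imports Defs "HOL-Computational_Algebra.Fundamental_Theorem_Algebra"
begin

text \<open>Time is cut into periods of length L. During all but the last n steps of a period the encoder
  repeatedly sends single components, along the right singular vectors of A^L, of the part of the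
  state at the start of the period that is not yet known to the controller. A use of the channel at
  power P divides the variance of the chosen component by 1 + P/N. Since |det A|^2 is the L-th root
  of the product of the squared singular values of A^L, and these singular values are bounded below
  up to a subexponential factor because no eigenvalue lies inside the unit disc, a long enough period
  has room to halve the mean square of A^L applied to the error. The controller copies each received
  value into its control, so that the encoder can compute the estimate linearly from the past
  controls; by controllability, the last n controls of the period cancel both the estimated state and
  these copies. The mean squares at the starts of the periods then satisfy a contracting recursion.
  Only second moments enter, so of independence only uncorrelatedness is used; the finite entropy of
  the initial state keeps all variances positive, so that the power can be kept at exactly P.\<close>

section \<open>Powers of expanding matrices and their singular values\<close>

text \<open>A direction needs channel uses in proportion to the logarithm of its expansion, but a
  single use is indivisible. This forces long periods: rounding, the n steering slots and all
  constants cost a bounded number of slots, and the subexponential loss an arbitrarily small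
  fraction of \<open>L\<close>, against a slack that grows linearly with \<open>L\<close>. Two
  difficulties shape the scheme. The components of the error are correlated in a way that changes
  with every use. In the right singular basis of A^L this never matters: the mean square of A^L e is
  a weighted sum of the second moments of single components, without cross terms. The same basis
  makes a Jordan form of A unnecessary. Secondly, fresh plant noise would enter while a component is
  being refined. The encoder therefore keeps describing the state at the start of the period; the
  plant noise of a period is uncorrelated with everything sent during it and joins the error only
  when the period ends.\<close>

lemma linear_funpow:
  fixes f :: "'a::real_vector \<Rightarrow> 'a"
  assumes "linear f"
  shows "linear (f ^^ t)"
proof (induction t)
  case (Suc t)
  then show ?case
    using linear_compose[OF Suc assms] by (simp add: o_def)
qed (simp add: linear_id[unfolded id_def])

lemma matrix_power_det:
  fixes A :: "real^'n^'n"
  shows "det (matrix ((*v) A ^^ t)) = det A ^ t"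
proof (induction t)
  case 0
  then show ?case by (simp add: matrix_id_mat_1[unfolded id_def])
next
  case (Suc t)
  have "linear ((*v) A ^^ t)"
    by (rule linear_funpow) simp
  then have "matrix ((*v) A ^^ Suc t) = A ** matrix ((*v) A ^^ t)"
    by (simp add: matrix_compose matrix_of_matrix_vector_mul)
  then show ?case
    using Suc by (simp add: det_mul o_def)
qed

text \<open>The notion \<open>dependent\<close> concerns sets, whereas the powers of a matrix
  applied to a vector may repeat; a repetition yields a relation with coefficients 1 and -1.\<close>

lemma linear_dependence_coefficients:
  fixes f :: "nat \<Rightarrow> 'a::euclidean_space"
  assumes "DIM('a) \<le> n"
  obtains c where "\<exists>i\<le>n. c i \<noteq> 0" "(\<Sum>i\<le>n. c i *\<^sub>R f i) = 0"
proof (cases "inj_on f {..n}")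
  case True
  then have "card (f ` {..n}) = Suc n"
    by (simp add: card_image)
  then have "dependent (f ` {..n})"
    using assms by (intro dependent_biggerset) auto
  then obtain u where u: "\<exists>v\<in>f ` {..n}. u v \<noteq> 0" "(\<Sum>v\<in>f ` {..n}. u v *\<^sub>R v) = 0"
    by (auto simp: dependent_finite)
  show ?thesis
    using u that[of "u \<circ> f"] by (auto simp: sum.reindex[OF True])
next
  case False
  then obtain a b where ab: "a \<le> n" "b \<le> n" "a \<noteq> b" "f a = f b"
    by (auto simp: inj_on_def)
  define c :: "nat \<Rightarrow> real" where "c i = (if i = a then 1 else if i = b then - 1 else 0)" for i
  have "(\<Sum>i\<le>n. c i *\<^sub>R f i) = (\<Sum>i\<in>{a, b}. c i *\<^sub>R f i)"
    using ab by (intro sum.mono_neutral_right) (auto simp: c_def)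
  also have "\<dots> = 0"
    using ab by (simp add: c_def)
  finally show ?thesis
    by (intro that[of c] exI[of _ a]) (use ab in \<open>auto simp: c_def\<close>)
qed

section \<open>Growth of matrix powers under a bound on the eigenvalues\<close>

definition poly_apply :: "complex^'n^'n \<Rightarrow> complex poly \<Rightarrow> complex^'n \<Rightarrow> complex^'n" where
  "poly_apply C p x = (\<Sum>i\<le>degree p. coeff p i *s ((*v) C ^^ i) x)"

lemma poly_apply_bound:
  assumes "degree p \<le> n"
  shows "poly_apply C p x = (\<Sum>i\<le>n. coeff p i *s ((*v) C ^^ i) x)"
  unfolding poly_apply_def using assms
  by (intro sum.mono_neutral_left) (auto simp: coeff_eq_0)

lemma matrix_vector_mult_sum_vec:
  fixes C :: "'a::field^'n^'m"
  shows "C *v (\<Sum>i\<in>I. f i) = (\<Sum>i\<in>I. C *v f i)"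
  by (induction I rule: infinite_finite_induct) (auto simp: matrix_vector_right_distrib)

text \<open>Matrix powers commute with C - \<mu>, so the factor may act first or last. Acting first,
  it replaces x by a vector annihilated by a polynomial of lower degree; acting last, it exhibits
  p(C) x as an eigenvector or zero.\<close>

lemma poly_apply_linear_factor:
  "poly_apply C ([:- \<mu>, 1:] * p) x = poly_apply C p (C *v x - \<mu> *s x)"
  "poly_apply C ([:- \<mu>, 1:] * p) x = C *v poly_apply C p x - \<mu> *s poly_apply C p x"
proof -
  define n where "n = degree p"
  have pow: "((*v) C ^^ i) (C *v x - \<mu> *s x) = ((*v) C ^^ Suc i) x - \<mu> *s ((*v) C ^^ i) x" for i
    by (induction i) (auto simp: matrix_vector_mult_diff_distrib vector_scalar_commute)
  have deg: "degree ([:- \<mu>, 1:] * p) \<le> Suc n"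
    using degree_mult_le[of "[:- \<mu>, 1:]" p] by (simp add: n_def)
  have "poly_apply C ([:- \<mu>, 1:] * p) x
      = (\<Sum>i\<le>Suc n. coeff (pCons 0 p) i *s ((*v) C ^^ i) x) - (\<Sum>i\<le>Suc n. (\<mu> * coeff p i) *s ((*v) C ^^ i) x)"
  proof -
    have "coeff ([:- \<mu>, 1:] * p) i = coeff (pCons 0 p) i - \<mu> * coeff p i" for i
      by simp
    then show ?thesis
      by (simp only: poly_apply_bound[OF deg] sum_subtractf[symmetric] vec.scale_left_diff_distrib)
  qed
  also have "(\<Sum>i\<le>Suc n. coeff (pCons 0 p) i *s ((*v) C ^^ i) x) = (\<Sum>i\<le>n. coeff p i *s ((*v) C ^^ Suc i) x)"
    by (subst sum.atMost_Suc_shift) simp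
  also have "(\<Sum>i\<le>Suc n. (\<mu> * coeff p i) *s ((*v) C ^^ i) x) = (\<Sum>i\<le>n. (\<mu> * coeff p i) *s ((*v) C ^^ i) x)"
    by (simp add: n_def coeff_eq_0)
  finally have *: "poly_apply C ([:- \<mu>, 1:] * p) x
      = (\<Sum>i\<le>n. coeff p i *s ((*v) C ^^ Suc i) x) - (\<Sum>i\<le>n. (\<mu> * coeff p i) *s ((*v) C ^^ i) x)" .
  have "coeff p i *s ((*v) C ^^ Suc i) x - (\<mu> * coeff p i) *s ((*v) C ^^ i) x
      = coeff p i *s ((*v) C ^^ i) (C *v x - \<mu> *s x)" for i
    unfolding pow vec.scale_right_diff_distrib vector_smult_assoc by (simp only: mult.commute)
  then show "poly_apply C ([:- \<mu>, 1:] * p) x = poly_apply C p (C *v x - \<mu> *s x)"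
    unfolding * poly_apply_bound[of p n, OF eq_refl, OF n_def[symmetric]] by (simp only: sum_subtractf[symmetric])
  have "C *v poly_apply C p x = (\<Sum>i\<le>n. coeff p i *s ((*v) C ^^ Suc i) x)"
    by (simp add: poly_apply_def n_def matrix_vector_mult_sum_vec vector_scalar_commute)
  moreover have "\<mu> *s poly_apply C p x = (\<Sum>i\<le>n. (\<mu> * coeff p i) *s ((*v) C ^^ i) x)"
    by (simp add: poly_apply_def n_def vec.scale_sum_right vector_smult_assoc)
  ultimately show "poly_apply C ([:- \<mu>, 1:] * p) x = C *v poly_apply C p x - \<mu> *s poly_apply C p x"
    unfolding * by simp
qed

text \<open>The geometric series sums to K / \<epsilon>. The rate 1 + \<epsilon> comes out unchanged
  and only the constant grows, so an induction over the roots of a polynomial can keep one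
  \<epsilon> throughout.\<close>

lemma affine_recurrence_growth:
  fixes a :: "nat \<Rightarrow> real"
  assumes "\<epsilon> > 0" "K \<ge> 0" "\<And>t. a (Suc t) \<le> a t + K * (1 + \<epsilon>) ^ t"
  shows "a t \<le> (\<bar>a 0\<bar> + K / \<epsilon>) * (1 + \<epsilon>) ^ t"
proof -
  have "a t \<le> \<bar>a 0\<bar> + K / \<epsilon> * ((1 + \<epsilon>) ^ t - 1)"
  proof (induction t)
    case (Suc t)
    have "K / \<epsilon> * ((1 + \<epsilon>) ^ Suc t - 1) = K / \<epsilon> * ((1 + \<epsilon>) ^ t - 1) + K * (1 + \<epsilon>) ^ t"
      using \<open>\<epsilon> > 0\<close> by (simp add: field_simps)
    then show ?case
      using assms(3)[of t] Suc by linarith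
  qed simp
  also have "\<dots> \<le> \<bar>a 0\<bar> * (1 + \<epsilon>) ^ t + K / \<epsilon> * (1 + \<epsilon>) ^ t"
  proof (rule add_mono)
    have "1 \<le> (1 + \<epsilon>) ^ t"
      using \<open>\<epsilon> > 0\<close> by (intro one_le_power) simp
    then show "\<bar>a 0\<bar> \<le> \<bar>a 0\<bar> * (1 + \<epsilon>) ^ t"
      by (simp add: mult_le_cancel_left1)
    show "K / \<epsilon> * ((1 + \<epsilon>) ^ t - 1) \<le> K / \<epsilon> * (1 + \<epsilon>) ^ t"
      using assms by (intro mult_left_mono) auto
  qed
  finally show ?thesis
    by (simp add: distrib_right)
qed

lemma norm_complex_vector_smult: "norm (c *s (x :: complex^'n)) = cmod c * norm x"
  by (simp add: norm_vec_def norm_mult L2_set_right_distrib)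

text \<open>Peel off the linear factors of an annihilating polynomial one at a time: a root outside the
  closed unit disc is no eigenvalue, so its factor can be cancelled; any other root adds one
  solution of a recurrence with multiplier of modulus at most 1.\<close>

lemma poly_annihilated_growth:
  fixes C :: "complex^'n^'n"
  assumes eig: "\<And>\<mu> x. x \<noteq> 0 \<Longrightarrow> C *v x = \<mu> *s x \<Longrightarrow> cmod \<mu> \<le> 1"
    and "\<epsilon> > 0" "p \<noteq> 0" "poly_apply C p x = 0"
  shows "\<exists>K\<ge>0. \<forall>t. norm (((*v) C ^^ t) x) \<le> K * (1 + \<epsilon>) ^ t"
  using \<open>p \<noteq> 0\<close> \<open>poly_apply C p x = 0\<close>
proof (induction "degree p" arbitrary: p x)
  case 0
  then obtain c where "p = [:c:]" "c \<noteq> 0"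
    by (metis degree_eq_zeroE pCons_0_0)
  with 0 have "x = 0"
    by (simp add: poly_apply_def)
  have "((*v) C ^^ t) (0 :: complex^'n) = 0" for t
    by (induction t) auto
  then show ?case
    using \<open>x = 0\<close> by (intro exI[of _ 0]) simp
next
  case (Suc d)
  have "\<not> constant (poly p)"
    using Suc.hyps(2) by (simp add: constant_degree)
  then obtain \<mu> where "poly p \<mu> = 0"
    using fundamental_theorem_of_algebra by blast
  then obtain r where r: "p = [:- \<mu>, 1:] * r"
    by (metis dvdE poly_eq_0_iff_dvd)
  have "r \<noteq> 0"
    using Suc.prems r by auto
  then have deg: "degree r = d"
    using Suc.hyps(2) degree_mult_eq[of "[:- \<mu>, 1:]" r] unfolding r by simp
  show ?case
  proof (cases "cmod \<mu> \<le> 1")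
    case False
    then have "poly_apply C r x = 0"
      using eig[of "poly_apply C r x" \<mu>] Suc.prems(2) unfolding r poly_apply_linear_factor(2) by auto
    then show ?thesis
      using Suc.hyps(1) deg \<open>r \<noteq> 0\<close> by auto
  next
    case True
    obtain K where K: "K \<ge> 0" "\<And>t. norm (((*v) C ^^ t) (C *v x - \<mu> *s x)) \<le> K * (1 + \<epsilon>) ^ t"
      using Suc.hyps(1)[of r "C *v x - \<mu> *s x"] deg \<open>r \<noteq> 0\<close> Suc.prems(2)
      unfolding r poly_apply_linear_factor(1) by auto
    have "norm (((*v) C ^^ Suc t) x) \<le> norm (((*v) C ^^ t) x) + K * (1 + \<epsilon>) ^ t" for t
    proof -
      have "((*v) C ^^ Suc t) x = \<mu> *s ((*v) C ^^ t) x + ((*v) C ^^ t) (C *v x - \<mu> *s x)"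
        by (induction t) (auto simp: matrix_vector_mult_diff_distrib vector_scalar_commute
            matrix_vector_right_distrib)
      then have "norm (((*v) C ^^ Suc t) x) \<le> cmod \<mu> * norm (((*v) C ^^ t) x) + K * (1 + \<epsilon>) ^ t"
        using norm_triangle_ineq[of "\<mu> *s ((*v) C ^^ t) x" "((*v) C ^^ t) (C *v x - \<mu> *s x)"] K(2)[of t]
        by (simp add: norm_complex_vector_smult)
      also have "cmod \<mu> * norm (((*v) C ^^ t) x) \<le> norm (((*v) C ^^ t) x)"
        using True by (simp add: mult_left_le_one_le)
      finally show ?thesis
        by simp
    qed
    from affine_recurrence_growth[OF \<open>\<epsilon> > 0\<close> K(1), of "\<lambda>t. norm (((*v) C ^^ t) x)", OF this]
    show ?thesis
      using K(1) \<open>\<epsilon> > 0\<close> by (intro exI[of _ "norm x + K / \<epsilon>"]) auto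
  qed
qed

text \<open>More vectors C^i x than the real dimension of the space are linearly dependent, which
  gives x its own annihilating polynomial, with real coefficients, without Cayley-Hamilton. The
  constant K may depend on x.\<close>

lemma complex_matrix_power_growth:
  fixes C :: "complex^'n^'n"
  assumes eig: "\<And>\<mu> x. x \<noteq> 0 \<Longrightarrow> C *v x = \<mu> *s x \<Longrightarrow> cmod \<mu> \<le> 1" and "\<epsilon> > 0"
  shows "\<exists>K\<ge>0. \<forall>t. norm (((*v) C ^^ t) x) \<le> K * (1 + \<epsilon>) ^ t"
proof -
  define n where "n = DIM(complex^'n)"
  obtain c where c: "\<exists>i\<le>n. c i \<noteq> 0" "(\<Sum>i\<le>n. c i *\<^sub>R ((*v) C ^^ i) x) = 0"
    using linear_dependence_coefficients[of n "\<lambda>i. ((*v) C ^^ i) x"] unfolding n_def by blast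
  define p where "p = (\<Sum>i\<le>n. monom (complex_of_real (c i)) i)"
  have coeff: "coeff p i = (if i \<le> n then complex_of_real (c i) else 0)" for i
    by (auto simp: p_def coeff_sum coeff_monom if_distrib cong: if_cong)
  then have "degree p \<le> n"
    by (intro degree_le) auto
  have "complex_of_real r *s y = r *\<^sub>R y" for r and y :: "complex^'n"
    by (simp add: vec_eq_iff scaleR_conv_of_real[where 'a = complex])
  then have "poly_apply C p x = 0"
    using c(2) by (simp add: poly_apply_bound[OF \<open>degree p \<le> n\<close>] coeff)
  moreover have "p \<noteq> 0"
    using c(1) coeff by (metis coeff_0 of_real_eq_0_iff)
  ultimately show ?thesis
    by (intro poly_annihilated_growth[OF eig \<open>\<epsilon> > 0\<close>])
qed

definition complex_vec :: "real^'n \<Rightarrow> complex^'n" where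
  "complex_vec x = (\<chi> i. complex_of_real (x $ i))"

lemma map_matrix_complex_vec:
  "map_matrix complex_of_real A *v complex_vec x = complex_vec (A *v x)"
  by (simp add: vec_eq_iff complex_vec_def matrix_vector_mult_def)

lemma map_matrix_complex_mult:
  "map_matrix complex_of_real (A ** B) = map_matrix complex_of_real A ** map_matrix complex_of_real B"
  by (simp add: vec_eq_iff matrix_matrix_mult_def)

lemma norm_complex_vec [simp]: "norm (complex_vec x) = norm x"
  by (simp add: complex_vec_def norm_vec_def)

lemma eigenvalues_nonzero_invertible:
  fixes A :: "real^'n^'n"
  assumes "\<not> eigenvalue A 0"
  shows "invertible A"
proof -
  have "x = 0" if "A *v x = 0" for x
  proof (rule ccontr)
    assume "x \<noteq> 0"
    then have "complex_vec x \<noteq> 0"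
      by (simp add: complex_vec_def vec_eq_iff)
    moreover have "map_matrix complex_of_real A *v complex_vec x = 0 *s complex_vec x"
      unfolding map_matrix_complex_vec that by (simp add: complex_vec_def vec_eq_iff)
    ultimately show False
      using assms unfolding eigenvalue_def by blast
  qed
  then show ?thesis
    by (simp add: invertible_left_inverse matrix_left_invertible_ker)
qed

text \<open>The eigenvalues of the inverse are reciprocals of those of A and thus lie in the closed
  unit disc, so the growth bound applies to the inverse; then x is written as A^(-t) A^t x. The
  constants depending on the vector become uniform by expansion in the finite standard
  basis.\<close>

lemma expanding_power_lower_bound:
  fixes A :: "real^'n^'n"
  assumes eig: "\<And>\<mu>. eigenvalue A \<mu> \<Longrightarrow> cmod \<mu> \<ge> 1" and "\<epsilon> > 0"
  obtains K where "K \<ge> 1" "\<And>t x. norm x \<le> K * (1 + \<epsilon>) ^ t * norm (((*v) A ^^ t) x)"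
proof -
  have "\<not> eigenvalue A 0"
    using eig[of 0] by auto
  then obtain B where B: "A ** B = mat 1" "B ** A = mat 1"
    using eigenvalues_nonzero_invertible unfolding invertible_def by blast
  define C where "C = map_matrix complex_of_real B"
  have AC: "map_matrix complex_of_real A ** C = mat 1"
    unfolding C_def map_matrix_complex_mult[symmetric] B by (simp add: vec_eq_iff mat_def)
  have "cmod \<mu> \<le> 1" if "x \<noteq> 0" "C *v x = \<mu> *s x" for \<mu> x
  proof -
    have x: "x = \<mu> *s (map_matrix complex_of_real A *v x)"
      using arg_cong[OF that(2), of "(*v) (map_matrix complex_of_real A)"]
      by (simp add: matrix_vector_mul_assoc AC vector_scalar_commute)
    then have "\<mu> \<noteq> 0"
      using that(1) by auto
    then have "map_matrix complex_of_real A *v x = (1 / \<mu>) *s x"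
      by (subst (2) x) (simp add: vector_smult_assoc)
    then have "cmod (1 / \<mu>) \<ge> 1"
      using eig[of "1 / \<mu>"] that(1) unfolding eigenvalue_def by blast
    then show ?thesis
      using \<open>\<mu> \<noteq> 0\<close> by (simp add: norm_divide field_simps)
  qed
  then have "\<exists>K\<ge>0. \<forall>t. norm (((*v) C ^^ t) x) \<le> K * (1 + \<epsilon>) ^ t" for x
    using \<open>\<epsilon> > 0\<close> by (rule complex_matrix_power_growth)
  moreover have "norm (((*v) C ^^ t) (complex_vec x)) = norm (((*v) B ^^ t) x)" for t x
  proof -
    have "((*v) C ^^ t) (complex_vec x) = complex_vec (((*v) B ^^ t) x)"
      by (induction t) (simp_all add: C_def map_matrix_complex_vec)
    then show ?thesis
      by simp
  qed
  ultimately have "\<exists>K\<ge>0. \<forall>t. norm (((*v) B ^^ t) x) \<le> K * (1 + \<epsilon>) ^ t" for x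
    by metis
  then obtain k where k: "\<And>x. k x \<ge> 0" "\<And>x t. norm (((*v) B ^^ t) x) \<le> k x * (1 + \<epsilon>) ^ t"
    by metis
  \<comment> \<open>The summand 1 gives \<open>K\<close> at least 1, so that ln K is nonnegative
    when logarithms are taken later.\<close>
  define K where "K = 1 + (\<Sum>b\<in>Basis. k b)"
  have bound: "norm (((*v) B ^^ t) y) \<le> K * (1 + \<epsilon>) ^ t * norm y" for t y
  proof -
    have lin: "linear ((*v) B ^^ t)"
      by (rule linear_funpow) simp
    have "norm (((*v) B ^^ t) y) = norm (\<Sum>b\<in>Basis. (y \<bullet> b) *\<^sub>R ((*v) B ^^ t) b)"
      by (subst euclidean_representation[of y, symmetric])
        (simp add: linear_sum[OF lin] linear_cmul[OF lin])
    also have "\<dots> \<le> (\<Sum>b\<in>Basis. norm y * (k b * (1 + \<epsilon>) ^ t))"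
    proof (rule sum_norm_le)
      fix b :: "real^'n" assume "b \<in> Basis"
      then show "norm ((y \<bullet> b) *\<^sub>R ((*v) B ^^ t) b) \<le> norm y * (k b * (1 + \<epsilon>) ^ t)"
        unfolding norm_scaleR using k(2)[of t b] Basis_le_norm[of b y] by (intro mult_mono) auto
    qed
    also have "\<dots> = (\<Sum>b\<in>Basis. k b) * ((1 + \<epsilon>) ^ t * norm y)"
      by (simp add: sum_distrib_right sum_distrib_left algebra_simps)
    also have "\<dots> \<le> K * ((1 + \<epsilon>) ^ t * norm y)"
      using \<open>\<epsilon> > 0\<close> by (intro mult_right_mono) (auto simp: K_def)
    finally show ?thesis
      by (simp add: mult.assoc)
  qed
  have inv: "((*v) B ^^ t) (((*v) A ^^ t) x) = x" for t x
  proof (induction t)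
    case (Suc t)
    have "((*v) B ^^ Suc t) (((*v) A ^^ Suc t) x) = ((*v) B ^^ t) (B *v (A *v ((*v) A ^^ t) x))"
      by (simp only: funpow.simps o_def funpow_swap1[of "(*v) B"])
    then show ?case
      using Suc B(2) by (simp add: matrix_vector_mul_assoc)
  qed simp
  have "norm x \<le> K * (1 + \<epsilon>) ^ t * norm (((*v) A ^^ t) x)" for t x
    using bound[of t "((*v) A ^^ t) x"] unfolding inv .
  moreover have "K \<ge> 1"
    using k(1) by (simp add: K_def sum_nonneg)
  ultimately show ?thesis
    using that by blast
qed

section \<open>Right singular vectors and the determinant\<close>

text \<open>The first-order condition at a maximum in algebraic form: for small t the linear term
  would dominate both quadratic ones.\<close>

lemma zero_if_quadratic_bound:
  fixes b c d :: real
  assumes "\<And>t. 2 * t * b + t\<^sup>2 * c \<le> t\<^sup>2 * d"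
  shows "b = 0"
proof (rule ccontr)
  assume "b \<noteq> 0"
  \<comment> \<open>Chosen larger than d - c and positive, so that at t = b / e the linear term 2
    b^2 / e exceeds the quadratic gap, which is at most b^2 / e.\<close>
  define e where "e = \<bar>d - c\<bar> + 1"
  have "2 * (b / e) * b + (b / e)\<^sup>2 * c \<le> (b / e)\<^sup>2 * d"
    by (rule assms)
  then have "2 * b\<^sup>2 / e \<le> (b / e)\<^sup>2 * (d - c)"
    by (simp add: algebra_simps power2_eq_square diff_divide_distrib)
  also have "\<dots> \<le> (b / e)\<^sup>2 * e"
    by (intro mult_left_mono) (auto simp: e_def)
  also have "\<dots> = b\<^sup>2 / e"
    by (simp add: power2_eq_square e_def)
  finally show False
    using \<open>b \<noteq> 0\<close> by (simp add: e_def divide_le_cancel)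
qed

text \<open>The right singular vectors of G, found one at a time by maximising the norm of G x over the
  unit sphere of the orthogonal complement of those already found.\<close>

lemma right_singular_vectors_aux:
  fixes G :: "'a::euclidean_space \<Rightarrow> 'b::euclidean_space"
  assumes "linear G" and "k \<le> DIM('a)"
  shows "\<exists>F. finite F \<and> card F = k \<and> (\<forall>f\<in>F. norm f = 1) \<and> pairwise orthogonal F \<and>
    (\<forall>f\<in>F. \<forall>g\<in>F. f \<noteq> g \<longrightarrow> G f \<bullet> G g = 0) \<and>
    (\<forall>u. (\<forall>f\<in>F. u \<bullet> f = 0) \<longrightarrow> (\<forall>f\<in>F. G u \<bullet> G f = 0))"
  using \<open>k \<le> DIM('a)\<close>
proof (induction k)
  case 0
  then show ?case
    by (intro exI[of _ "{}"]) auto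
next
  case (Suc k)
  then obtain F where F: "finite F" "card F = k" "\<forall>f\<in>F. norm f = 1" "pairwise orthogonal F"
    "\<forall>f\<in>F. \<forall>g\<in>F. f \<noteq> g \<longrightarrow> G f \<bullet> G g = 0"
    "\<And>u. \<forall>f\<in>F. u \<bullet> f = 0 \<Longrightarrow> \<forall>f\<in>F. G u \<bullet> G f = 0"
    by auto
  define S where "S = {u. \<forall>f\<in>F. u \<bullet> f = 0}"
  have "dim (span F) < DIM('a)"
    using F(1,2) Suc.prems dim_le_card'[of F] by simp
  then obtain w where w: "w \<noteq> 0" "\<And>f. f \<in> span F \<Longrightarrow> orthogonal w f"
    using orthogonal_to_subspace_exists[of F] by (auto simp: span_span)
  have "closed S"
  proof -
    have "S = (\<Inter>f\<in>F. {u. f \<bullet> u = 0})"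
      by (auto simp: S_def inner_commute)
    then show ?thesis
      by (simp add: closed_INT closed_hyperplane)
  qed
  then have "compact (S \<inter> sphere 0 1)"
    by (simp add: compact_Int_closed closed_Int_compact)
  moreover have "(1 / norm w) *\<^sub>R w \<in> S \<inter> sphere 0 1"
    using w by (auto simp: S_def orthogonal_def span_base)
  moreover have "continuous_on (S \<inter> sphere 0 1) (\<lambda>x. norm (G x))"
    using linear_continuous_on[OF linear_linear[THEN iffD2, OF assms(1)]] by (intro continuous_on_norm) auto
  ultimately obtain v where v: "v \<in> S" "norm v = 1"
    and max: "\<And>x. x \<in> S \<Longrightarrow> norm x = 1 \<Longrightarrow> norm (G x) \<le> norm (G v)"
    using continuous_attains_sup[of "S \<inter> sphere 0 1" "\<lambda>x. norm (G x)"]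
    by (metis (no_types, lifting) IntE IntI empty_iff mem_sphere_0)
  \<comment> \<open>Homogeneity removes the unit norm constraint, so \<open>v\<close> can be
    compared with v + t u of any length.\<close>
  have bound: "norm (G x) \<le> norm (G v) * norm x" if "x \<in> S" for x
  proof (cases "x = 0")
    case False
    have "norm (G ((1 / norm x) *\<^sub>R x)) \<le> norm (G v)"
      using that False by (intro max) (auto simp: S_def)
    then show ?thesis
      using False by (simp add: linear_cmul[OF assms(1)] field_simps)
  qed (simp add: linear_0[OF assms(1)])
  have orth: "G u \<bullet> G v = 0" if u: "u \<in> S" "u \<bullet> v = 0" for u
  proof (rule zero_if_quadratic_bound)
    fix t :: real
    have "v + t *\<^sub>R u \<in> S"
      using u v by (auto simp: S_def inner_add_left)
    then have "(norm (G (v + t *\<^sub>R u)))\<^sup>2 \<le> (norm (G v) * norm (v + t *\<^sub>R u))\<^sup>2"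
      by (intro power_mono bound) auto
    moreover have "(norm (G (v + t *\<^sub>R u)))\<^sup>2 = (norm (G v))\<^sup>2 + 2 * t * (G u \<bullet> G v) + t\<^sup>2 * (norm (G u))\<^sup>2"
      unfolding power2_norm_eq_inner linear_add[OF assms(1)] linear_cmul[OF assms(1)]
      by (simp add: inner_simps inner_commute algebra_simps power2_eq_square)
    moreover have "(norm (v + t *\<^sub>R u))\<^sup>2 = 1 + t\<^sup>2 * (norm u)\<^sup>2"
      using u v unfolding power2_norm_eq_inner
      by (simp add: inner_simps inner_commute algebra_simps power2_eq_square norm_eq_1)
    ultimately show "2 * t * (G u \<bullet> G v) + t\<^sup>2 * (norm (G u))\<^sup>2 \<le> t\<^sup>2 * ((norm (G v))\<^sup>2 * (norm u)\<^sup>2)"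
      by (simp add: power_mult_distrib algebra_simps)
  qed
  have "v \<notin> F"
    using v by (force simp: S_def)
  show ?case
  proof (intro exI[of _ "insert v F"] conjI)
    show "card (insert v F) = Suc k"
      using F \<open>v \<notin> F\<close> by simp
    show "pairwise orthogonal (insert v F)"
      using F(4) v(1) by (auto simp: pairwise_insert S_def orthogonal_def inner_commute)
    \<comment> \<open>The last clause of the induction hypothesis is what is needed here:
      \<open>v\<close> is orthogonal to \<open>F\<close>, hence its image is orthogonal to the old
      images.\<close>
    show "\<forall>f\<in>insert v F. \<forall>g\<in>insert v F. f \<noteq> g \<longrightarrow> G f \<bullet> G g = 0"
      using F(5) F(6)[of v] v(1) by (auto simp: S_def inner_commute)
    show "\<forall>u. (\<forall>f\<in>insert v F. u \<bullet> f = 0) \<longrightarrow> (\<forall>f\<in>insert v F. G u \<bullet> G f = 0)"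
      using F(6) orth by (auto simp: S_def)
  qed (use F v in auto)
qed

lemma right_singular_vectors:
  fixes G :: "real^'n \<Rightarrow> 'b::euclidean_space"
  assumes "linear G"
  obtains v :: "'n \<Rightarrow> real^'n" where "\<And>i j. v i \<bullet> v j = (if i = j then 1 else 0)"
    "\<And>i j. i \<noteq> j \<Longrightarrow> G (v i) \<bullet> G (v j) = 0"
proof -
  obtain F :: "(real^'n) set" where F: "finite F" "card F = CARD('n)" "\<forall>f\<in>F. norm f = 1" "pairwise orthogonal F"
    "\<forall>f\<in>F. \<forall>g\<in>F. f \<noteq> g \<longrightarrow> G f \<bullet> G g = 0"
    using right_singular_vectors_aux[OF assms, of "CARD('n)"] by auto
  obtain v where v: "bij_betw v (UNIV :: 'n set) F"
    using F(1,2) finite_same_card_bij[of "UNIV :: 'n set" F] by auto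
  then have inj: "v i = v j \<longleftrightarrow> i = j" and mem: "v i \<in> F" for i j
    by (auto simp: bij_betw_def inj_eq)
  show ?thesis
  proof (rule that[of v])
    show "v i \<bullet> v j = (if i = j then 1 else 0)" for i j
      using F(3,4) mem[of i] mem[of j] inj[of i j] by (auto simp: norm_eq_1 pairwise_def orthogonal_def)
    show "G (v i) \<bullet> G (v j) = 0" if "i \<noteq> j" for i j
      using F(5) mem[of i] mem[of j] inj[of i j] that by auto
  qed
qed

text \<open>With V the orthogonal matrix of rows \<open>v i\<close>, the rows of H = V G^T are the
  images G (v i). They are pairwise orthogonal, so H H^T is diagonal, and its determinant is (det
  G)^2.\<close>

lemma det_from_right_singular_vectors:
  fixes G :: "real^'n \<Rightarrow> real^'n" and v :: "'n \<Rightarrow> real^'n"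
  assumes "linear G" and v: "\<And>i j. v i \<bullet> v j = (if i = j then 1 else 0)"
    and Gv: "\<And>i j. i \<noteq> j \<Longrightarrow> G (v i) \<bullet> G (v j) = 0"
  shows "(det (matrix G))\<^sup>2 = (\<Prod>i\<in>UNIV. (norm (G (v i)))\<^sup>2)"
proof -
  define V where "V = (\<chi> i. v i)"
  have row: "(V ** transpose C) $ i $ j = v i \<bullet> C $ j" for C :: "real^'n^'n" and i j
    by (simp add: V_def matrix_matrix_mult_def transpose_def inner_vec_def)
  have "V ** transpose V = mat 1"
    by (simp add: vec_eq_iff row) (simp add: V_def v mat_def)
  then have "(det V)\<^sup>2 = 1"
    by (metis det_I det_mul det_transpose power2_eq_square)
  define H where "H = (\<chi> i. G (v i))"
  have H: "H = V ** transpose (matrix G)"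
  proof -
    have "G (v i) $ j = v i \<bullet> matrix G $ j" for i j
      by (subst matrix_vector_mul(2)[OF assms(1), symmetric])
        (simp add: matrix_vector_mult_def inner_vec_def mult.commute)
    then show ?thesis
      by (simp add: vec_eq_iff row) (simp add: H_def)
  qed
  have "det (H ** transpose H) = (\<Prod>i\<in>UNIV. (H ** transpose H) $ i $ i)"
    by (intro det_diagonal) (simp add: H_def matrix_matrix_mult_def transpose_def Gv[unfolded inner_vec_def inner_real_def])
  also have "\<dots> = (\<Prod>i\<in>UNIV. (norm (G (v i)))\<^sup>2)"
    by (simp add: H_def matrix_matrix_mult_def transpose_def power2_norm_eq_inner inner_vec_def)
  finally have "det (H ** transpose H) = (\<Prod>i\<in>UNIV. (norm (G (v i)))\<^sup>2)" .
  moreover have "det (H ** transpose H) = (det (matrix G))\<^sup>2"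
    using \<open>(det V)\<^sup>2 = 1\<close> by (simp add: H det_mul det_transpose power2_eq_square matrix_transpose_mul transpose_transpose)
  ultimately show ?thesis
    by simp
qed

text \<open>Taking \<epsilon> = exp \<delta> - 1 turns the growth factor into exp (\<delta> t); the
  factor 2 and the constant 2 ln K come from squaring the norm.\<close>

lemma singular_value_lower_bound:
  fixes A :: "real^'n^'n"
  assumes "\<And>\<mu>. eigenvalue A \<mu> \<Longrightarrow> cmod \<mu> \<ge> 1" and "\<delta> > 0"
  obtains c where "c \<ge> 0"
    "\<And>t x. norm x = 1 \<Longrightarrow> ((*v) A ^^ t) x \<noteq> 0 \<and> ln ((norm (((*v) A ^^ t) x))\<^sup>2) \<ge> - c - 2 * \<delta> * real t"
proof -
  have "exp \<delta> - 1 > 0"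
    using \<open>\<delta> > 0\<close> by simp
  from expanding_power_lower_bound[OF assms(1) this] obtain K where K: "K \<ge> 1"
    "\<And>t x. norm x \<le> K * exp \<delta> ^ t * norm (((*v) A ^^ t) x)"
    by auto
  have "((*v) A ^^ t) x \<noteq> 0 \<and> ln ((norm (((*v) A ^^ t) x))\<^sup>2) \<ge> - (2 * ln K) - 2 * \<delta> * real t" if "norm x = 1" for t x
  proof -
    define y where "y = norm (((*v) A ^^ t) x)"
    have *: "1 \<le> K * exp \<delta> ^ t * y"
      using K(2)[of x t] that by (simp add: y_def)
    then have "y \<noteq> 0"
      by auto
    then have "y > 0"
      by (simp add: y_def)
    have "0 \<le> ln (K * exp \<delta> ^ t * y)"
      using * by simp
    also have "\<dots> = ln K + \<delta> * real t + ln y"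
      using K(1) \<open>y > 0\<close> by (simp add: ln_mult ln_realpow)
    finally have "- (2 * ln K) - 2 * \<delta> * real t \<le> ln (y\<^sup>2)"
      using \<open>y > 0\<close> by (simp add: ln_realpow)
    then show ?thesis
      using \<open>y > 0\<close> by (auto simp: y_def)
  qed
  then show ?thesis
    using K(1) by (intro that[of "2 * ln K"]) auto
qed

lemma ln_det_power_singular_values:
  fixes A :: "real^'n^'n" and v :: "'n \<Rightarrow> real^'n"
  assumes v: "\<And>i j. v i \<bullet> v j = (if i = j then 1 else 0)"
    and "\<And>i j. i \<noteq> j \<Longrightarrow> ((*v) A ^^ t) (v i) \<bullet> ((*v) A ^^ t) (v j) = 0"
    and "\<And>i. ((*v) A ^^ t) (v i) \<noteq> 0" and "det A \<noteq> 0"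
  shows "(\<Sum>i\<in>UNIV. ln ((norm (((*v) A ^^ t) (v i)))\<^sup>2)) = real t * ln ((det A)\<^sup>2)"
proof -
  have "(\<Prod>i\<in>UNIV. (norm (((*v) A ^^ t) (v i)))\<^sup>2) = ((det A)\<^sup>2) ^ t"
    using det_from_right_singular_vectors[OF linear_funpow, of "(*v) A" v t] assms(1,2)
    by (simp add: matrix_power_det power_mult[symmetric] mult.commute)
  then have "ln (\<Prod>i\<in>UNIV. (norm (((*v) A ^^ t) (v i)))\<^sup>2) = real t * ln ((det A)\<^sup>2)"
    using \<open>det A \<noteq> 0\<close> by (simp add: ln_realpow)
  then show ?thesis
    using assms(3) by (subst (asm) ln_prod) auto
qed

section \<open>Counting the channel uses of a period\<close>

text \<open>Obtained from the singular values instead of the product of the eigenvalues: if |det A|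
  < 1, their logarithms would sum to a negative multiple of t, below the subexponential lower bound
  for large t.\<close>

lemma abs_det_ge_1:
  fixes A :: "real^'n^'n"
  assumes eig: "\<And>\<mu>. eigenvalue A \<mu> \<Longrightarrow> cmod \<mu> \<ge> 1"
  shows "\<bar>det A\<bar> \<ge> 1"
proof (rule ccontr)
  assume "\<not> \<bar>det A\<bar> \<ge> 1"
  moreover have "det A \<noteq> 0"
    using eig[of 0] eigenvalues_nonzero_invertible[of A] by (auto simp: invertible_det_nz)
  ultimately have "ln ((det A)\<^sup>2) < 0"
    by (simp add: abs_square_less_1)
  define n where "n = real CARD('n)"
  have "n > 0"
    by (simp add: n_def)
  define D where "D = - ln ((det A)\<^sup>2)"
  have "D > 0"
    using \<open>ln ((det A)\<^sup>2) < 0\<close> by (simp add: D_def)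
  \<comment> \<open>With this \<delta> the n lower bounds lose 2 n \<delta> t = t D / 2 in total,
    only half of the assumed decay t D.\<close>
  then have "D / (4 * n) > 0"
    using \<open>n > 0\<close> by simp
  from singular_value_lower_bound[OF eig this] obtain c where c: "c \<ge> 0"
    "\<And>t x. norm x = 1 \<Longrightarrow> ((*v) A ^^ t) x \<noteq> 0 \<and> ln ((norm (((*v) A ^^ t) x))\<^sup>2) \<ge> - c - 2 * (D / (4 * n)) * real t"
    by metis
  have "real t * D \<le> 2 * n * c" for t
  proof -
    obtain v :: "'n \<Rightarrow> real^'n" where v: "\<And>i j. v i \<bullet> v j = (if i = j then 1 else 0)"
      "\<And>i j. i \<noteq> j \<Longrightarrow> ((*v) A ^^ t) (v i) \<bullet> ((*v) A ^^ t) (v j) = 0"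
      using right_singular_vectors[OF linear_funpow[OF matrix_vector_mul_linear]] by blast
    have "norm (v i) = 1" for i
      using v(1)[of i i] by (simp add: norm_eq_1)
    note c = c(2)[OF this]
    have "n * (- c - 2 * (D / (4 * n)) * real t) = (\<Sum>i\<in>(UNIV :: 'n set). - c - 2 * (D / (4 * n)) * real t)"
      by (simp add: n_def)
    also have "\<dots> \<le> (\<Sum>i\<in>UNIV. ln ((norm (((*v) A ^^ t) (v i)))\<^sup>2))"
      using c by (intro sum_mono) auto
    also have "\<dots> = - (real t * D)"
      using ln_det_power_singular_values[OF v] c \<open>det A \<noteq> 0\<close> by (simp add: D_def)
    finally show ?thesis
      using \<open>n > 0\<close> by (simp add: field_simps)
  qed
  moreover obtain t :: nat where "real t > 2 * n * c / D"
    using reals_Archimedean2 by blast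
  ultimately show False
    using \<open>D > 0\<close> by (metis linorder_not_le pos_divide_less_eq)
qed

text \<open>The pairs of a direction i and an index below \<open>m i\<close> are injected into the
  slots, and \<open>sch\<close> reads the direction back. Slots outside the image receive arbitrary
  directions, hence an inequality only; extra uses do no harm.\<close>

lemma schedule_with_multiplicities:
  fixes m :: "'n::finite \<Rightarrow> nat"
  assumes "(\<Sum>i\<in>UNIV. m i) \<le> q"
  obtains sch where "\<And>i. m i \<le> card {s. s < q \<and> sch s = i}"
proof -
  define \<Sigma> where "\<Sigma> = (SIGMA i:UNIV. {..<m i})"
  have "finite \<Sigma>" "card \<Sigma> \<le> card {..<q}"
    using assms by (simp_all add: \<Sigma>_def)
  then obtain \<phi> where \<phi>: "\<phi> ` \<Sigma> \<subseteq> {..<q}" "inj_on \<phi> \<Sigma>"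
    by (metis card_le_inj finite_lessThan)
  define sch where "sch s = fst (inv_into \<Sigma> \<phi> s)" for s
  have "m i \<le> card {s. s < q \<and> sch s = i}" for i
  proof -
    have "m i = card (\<phi> ` ({i} \<times> {..<m i}))"
      by (subst card_image) (auto intro: inj_on_subset[OF \<phi>(2)] simp: \<Sigma>_def)
    also have "\<dots> \<le> card {s. s < q \<and> sch s = i}"
    proof (rule card_mono)
      show "\<phi> ` ({i} \<times> {..<m i}) \<subseteq> {s. s < q \<and> sch s = i}"
        using \<phi> by (auto simp: sch_def \<Sigma>_def inv_into_f_f)
    qed auto
    finally show ?thesis .
  qed
  then show ?thesis
    using that by blast
qed

text \<open>Contracting every direction as often as its singular value demands costs in total about
  ln |det A^L|^2 / - ln \<beta> slots; singular values below 1, whose logarithms cannot be credited, are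
  subexponentially close to 1.\<close>

lemma contracting_schedule:
  fixes A :: "real^'n^'n"
  assumes eig: "\<And>\<mu>. eigenvalue A \<mu> \<Longrightarrow> cmod \<mu> \<ge> 1"
    and "0 < \<beta>" "\<beta> < 1" "(det A)\<^sup>2 * \<beta> < 1"
  obtains L and v :: "'n \<Rightarrow> real^'n" and sch where "CARD('n) \<le> L"
    "\<And>i j. v i \<bullet> v j = (if i = j then 1 else 0)"
    "\<And>i j. i \<noteq> j \<Longrightarrow> ((*v) A ^^ L) (v i) \<bullet> ((*v) A ^^ L) (v j) = 0"
    "\<And>i. (norm (((*v) A ^^ L) (v i)))\<^sup>2 * \<beta> ^ card {s. s < L - CARD('n) \<and> sch s = i} \<le> 1 / 2"
proof -
  define n where "n = real CARD('n)"
  define l where "l = - ln \<beta>"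
  define D where "D = ln ((det A)\<^sup>2)"
  \<comment> \<open>The subexponential loss over n directions, 2 n \<delta> L = L (l - D) / 2, takes
    half of the available slack L (l - D).\<close>
  define \<delta> where "\<delta> = (l - D) / (4 * n)"
  have "n > 0" "l > 0"
    using assms by (simp_all add: n_def l_def)
  have det: "det A \<noteq> 0"
    using abs_det_ge_1[of A, OF eig] by auto
  then have "ln ((det A)\<^sup>2 * \<beta>) < 0"
    using assms by (intro ln_less_zero) auto
  then have "D < l"
    using assms det by (simp add: ln_mult D_def l_def)
  then have "\<delta> > 0"
    using \<open>n > 0\<close> by (simp add: \<delta>_def)
  obtain c where c: "c \<ge> 0"
    "\<And>t x. norm x = 1 \<Longrightarrow> ((*v) A ^^ t) x \<noteq> 0 \<and> ln ((norm (((*v) A ^^ t) x))\<^sup>2) \<ge> - c - 2 * \<delta> * real t"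
    using singular_value_lower_bound[OF eig \<open>\<delta> > 0\<close>] by metis
  \<comment> \<open>The other half of the slack must pay n (ln 2 + c) for the factor 1/2 and the
    constant of the singular value bound, n l for rounding up the numbers of uses, and n l for the n
    steering slots.\<close>
  obtain L0 :: nat where L0: "real L0 > (n * (ln 2 + c) + 2 * n * l) / ((l - D) / 2)"
    using reals_Archimedean2 by blast
  define L where "L = L0 + CARD('n)"
  have "real L0 * ((l - D) / 2) \<ge> n * (ln 2 + c) + 2 * n * l"
    using L0 \<open>D < l\<close> by (simp add: pos_divide_less_eq less_imp_le)
  moreover have "real L0 * ((l - D) / 2) \<le> real L * ((l - D) / 2)"
    using \<open>D < l\<close> by (intro mult_right_mono) (auto simp: L_def)
  ultimately have L: "real L * ((l - D) / 2) \<ge> n * (ln 2 + c) + 2 * n * l"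
    by linarith
  obtain v :: "'n \<Rightarrow> real^'n" where v: "\<And>i j. v i \<bullet> v j = (if i = j then 1 else 0)"
    "\<And>i j. i \<noteq> j \<Longrightarrow> ((*v) A ^^ L) (v i) \<bullet> ((*v) A ^^ L) (v j) = 0"
    using right_singular_vectors[OF linear_funpow[OF matrix_vector_mul_linear]] by blast
  have "norm (v i) = 1" for i
    using v(1)[of i i] by (simp add: norm_eq_1)
  note c = c(1) c(2)[OF this]
  define \<sigma> where "\<sigma> i = (norm (((*v) A ^^ L) (v i)))\<^sup>2" for i
  have \<sigma>: "\<sigma> i > 0" for i
    using c(2) by (simp add: \<sigma>_def)
  \<comment> \<open>The least number of uses after which \<sigma> i \<beta>^m is at most 1/2;
    \<open>nat\<close> clips it to 0 for directions that A^L already contracts enough.\<close>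
  define m where "m i = nat \<lceil>ln (2 * \<sigma> i) / l\<rceil>" for i
  have suff: "\<sigma> i * \<beta> ^ k \<le> 1 / 2" if "m i \<le> k" for i k
  proof -
    have "ln (2 * \<sigma> i) / l \<le> real (m i)"
      unfolding m_def by (rule real_nat_ceiling_ge)
    then have "ln (2 * \<sigma> i) \<le> real (m i) * l"
      using \<open>l > 0\<close> by (simp add: pos_divide_le_eq)
    also have "\<dots> \<le> real k * l"
      using that \<open>l > 0\<close> by (intro mult_right_mono) auto
    finally have "ln (2 * \<sigma> i * \<beta> ^ k) \<le> 0"
      using \<sigma>[of i] \<open>0 < \<beta>\<close> by (simp add: ln_mult ln_realpow l_def)
    then have "2 * \<sigma> i * \<beta> ^ k \<le> 1"
      using \<sigma>[of i] \<open>0 < \<beta>\<close> by (simp add: ln_le_zero_iff)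
    then show ?thesis
      by simp
  qed
  \<comment> \<open>The added c + 2 \<delta> L keeps the numerator nonnegative even where
    \<open>m i\<close> was clipped, so that one formula holds for all directions and can be summed
    against the determinant.\<close>
  have m: "real (m i) \<le> (ln 2 + ln (\<sigma> i) + (c + 2 * \<delta> * real L)) / l + 1" for i
  proof (cases "ln (2 * \<sigma> i) / l \<ge> 0")
    case True
    then have "real (m i) \<le> ln (2 * \<sigma> i) / l + 1"
      using \<open>l > 0\<close> unfolding m_def by linarith
    also have "\<dots> = (ln 2 + ln (\<sigma> i)) / l + 1"
      using \<sigma>[of i] by (simp add: ln_mult)
    also have "\<dots> \<le> (ln 2 + ln (\<sigma> i) + (c + 2 * \<delta> * real L)) / l + 1"
      using \<open>l > 0\<close> c(1) \<open>\<delta> > 0\<close> by (simp add: divide_right_mono)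
    finally show ?thesis .
  next
    case False
    then have "m i = 0"
      by (simp add: m_def)
    have "0 \<le> ln 2 + ln (\<sigma> i) + (c + 2 * \<delta> * real L)"
      using c(2)[of L i] ln_gt_zero[of "2 :: real"] unfolding \<sigma>_def by linarith
    then show ?thesis
      using \<open>l > 0\<close> by (simp add: \<open>m i = 0\<close>)
  qed
  have "real (\<Sum>i\<in>UNIV. m i) \<le> (\<Sum>i\<in>(UNIV :: 'n set). (ln 2 + ln (\<sigma> i) + (c + 2 * \<delta> * real L)) / l + 1)"
    unfolding of_nat_sum using m by (intro sum_mono) auto
  also have "\<dots> = (n * ln 2 + (\<Sum>i\<in>UNIV. ln (\<sigma> i)) + n * (c + 2 * \<delta> * real L)) / l + n"
    by (simp add: sum.distrib sum_divide_distrib[symmetric] n_def)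
  also have "(\<Sum>i\<in>UNIV. ln (\<sigma> i)) = real L * D"
    unfolding \<sigma>_def D_def using v c(2) det by (intro ln_det_power_singular_values) auto
  also have "n * (c + 2 * \<delta> * real L) = n * c + real L * ((l - D) / 2)"
    using \<open>n > 0\<close> by (simp add: \<delta>_def field_simps)
  also have "(n * ln 2 + real L * D + (n * c + real L * ((l - D) / 2))) / l + n \<le> real L - n"
  proof -
    have "n * ln 2 + real L * D + (n * c + real L * ((l - D) / 2)) \<le> (real L - 2 * n) * l"
      using L by (simp add: field_simps)
    then have "(n * ln 2 + real L * D + (n * c + real L * ((l - D) / 2))) / l \<le> real L - 2 * n"
      using \<open>l > 0\<close> by (simp only: pos_divide_le_eq)
    then show ?thesis
      by linarith
  qed
  also have "\<dots> = real (L - CARD('n))"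
    by (simp add: n_def L_def)
  finally have "(\<Sum>i\<in>UNIV. m i) \<le> L - CARD('n)"
    by linarith
  then obtain sch where "\<And>i. m i \<le> card {s. s < L - CARD('n) \<and> sch s = i}"
    using schedule_with_multiplicities by blast
  with suff v show ?thesis
    by (intro that[of L v sch]) (auto simp: L_def \<sigma>_def)
qed

text \<open>The reachable set is a subspace containing the generators of the controllability span,
  hence everything. Choosing controls for the unit vectors only and extending linearly makes
  \<open>ctl\<close> linear in its target. The index j is the number of plant steps that follow the
  one in which the control is applied.\<close>

lemma deadbeat_controls:
  fixes A :: "real^'n^'n" and B :: "real^'m^'n"
  assumes "controllable A B"
  obtains ctl :: "nat \<Rightarrow> real^'n \<Rightarrow> real^'m" where "\<And>j. linear (ctl j)"
    "\<And>z. (\<Sum>j<CARD('n). ((*v) A ^^ j) (B *v ctl j z)) = z"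
proof -
  define F where "F u = (\<Sum>j<CARD('n). ((*v) A ^^ j) (B *v u j))" for u :: "nat \<Rightarrow> real^'m"
  have lin: "linear ((*v) A ^^ j)" for j
    by (rule linear_funpow) simp
  have F_add: "F (\<lambda>j. u j + w j) = F u + F w" for u w
    by (simp add: F_def matrix_vector_right_distrib linear_add[OF lin] sum.distrib)
  have F_scale: "F (\<lambda>j. r *\<^sub>R u j) = r *\<^sub>R F u" for r u
    by (simp add: F_def matrix_vector_mult_scaleR linear_cmul[OF lin] scaleR_sum_right)
  have F_0: "F (\<lambda>j. 0) = 0"
    by (simp add: F_def linear_0[OF lin])
  have F_sum: "F (\<lambda>j. \<Sum>i\<in>I. u i j) = (\<Sum>i\<in>I. F (u i))" for I and u :: "'n \<Rightarrow> nat \<Rightarrow> real^'m"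
    by (induction I rule: infinite_finite_induct) (auto simp: F_0 F_add)
  have "subspace (range F)"
  proof (rule subspaceI)
    show "0 \<in> range F"
      using F_0 by (metis rangeI)
    show "x + y \<in> range F" if "x \<in> range F" "y \<in> range F" for x y
      using that F_add[symmetric] by auto
    show "r *\<^sub>R x \<in> range F" if "x \<in> range F" for r x
      using that F_scale[symmetric] by auto
  qed
  moreover have "((*v) A ^^ k) (column j B) \<in> range F" if "k < CARD('n)" for k j
  proof -
    have "F (\<lambda>i. if i = k then axis j 1 else 0) = (\<Sum>i\<in>{k}. ((*v) A ^^ i) (B *v axis j 1))"
      unfolding F_def using that
      by (intro sum.mono_neutral_cong_right) (auto simp: linear_0[OF lin])
    then show ?thesis
      by (simp add: matrix_vector_mult_basis) (metis rangeI)
  qed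
  ultimately have "span {((*v) A ^^ k) (column j B) | k j. k < CARD('n)} \<subseteq> range F"
    by (intro span_minimal) auto
  then have "range F = UNIV"
    using assms unfolding controllable_def by auto
  then have "\<forall>i. \<exists>w. F w = axis i 1"
    unfolding surj_def by (blast intro: sym)
  from choice[OF this] obtain u where u: "\<And>i. F (u i) = axis i 1"
    by blast
  define ctl where "ctl j z = (\<Sum>i\<in>UNIV. (z $ i) *\<^sub>R u i j)" for j and z :: "real^'n"
  have "F (\<lambda>j. ctl j z) = z" for z
    using basis_expansion[of z] unfolding ctl_def by (simp add: F_sum F_scale u scalar_mult_eq_scaleR)
  moreover have "linear (ctl j)" for j
    unfolding ctl_def by (intro linearI) (auto simp: scaleR_left_distrib sum.distrib scaleR_sum_right)
  ultimately show ?thesis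
    using that unfolding F_def by blast
qed

section \<open>Square-integrable random variables\<close>

definition square_integrable :: "'w measure \<Rightarrow> ('w \<Rightarrow> real) \<Rightarrow> bool" where
  "square_integrable M f \<longleftrightarrow> f \<in> borel_measurable M \<and> integrable M (\<lambda>\<omega>. (f \<omega>)\<^sup>2)"

definition mean_square :: "'w measure \<Rightarrow> ('w \<Rightarrow> real) \<Rightarrow> real" where
  "mean_square M f = (LINT \<omega>|M. (f \<omega>)\<^sup>2)"

text \<open>Orthogonality in L2, without subtraction of means, and \<open>mean_square\<close> is
  likewise an uncentred moment. This fits an initial state whose mean need not vanish.\<close>

definition uncorrelated :: "'w measure \<Rightarrow> ('w \<Rightarrow> real) \<Rightarrow> ('w \<Rightarrow> real) \<Rightarrow> bool" where
  "uncorrelated M f g \<longleftrightarrow> square_integrable M f \<and> square_integrable M g \<and> (LINT \<omega>|M. f \<omega> * g \<omega>) = 0"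

lemma square_integrable_mult:
  assumes "square_integrable M f" "square_integrable M g"
  shows "integrable M (\<lambda>\<omega>. f \<omega> * g \<omega>)"
proof (rule Bochner_Integration.integrable_bound)
  show "integrable M (\<lambda>\<omega>. (f \<omega>)\<^sup>2 + (g \<omega>)\<^sup>2)"
    using assms by (auto simp: square_integrable_def)
  show "(\<lambda>\<omega>. f \<omega> * g \<omega>) \<in> borel_measurable M"
    using assms by (auto simp: square_integrable_def)
  have "\<bar>x * y\<bar> \<le> x\<^sup>2 + y\<^sup>2" for x y :: real
  proof -
    have "2 * (\<bar>x\<bar> * \<bar>y\<bar>) \<le> x\<^sup>2 + y\<^sup>2"
      using sum_squares_bound[of "\<bar>x\<bar>" "\<bar>y\<bar>"] by (simp add: mult.assoc)
    moreover have "0 \<le> \<bar>x\<bar> * \<bar>y\<bar>"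
      by simp
    ultimately show ?thesis
      unfolding abs_mult by linarith
  qed
  then show "AE \<omega> in M. norm (f \<omega> * g \<omega>) \<le> norm ((f \<omega>)\<^sup>2 + (g \<omega>)\<^sup>2)"
    by simp
qed

lemma square_integrable_add:
  assumes "square_integrable M f" "square_integrable M g"
  shows "square_integrable M (\<lambda>\<omega>. f \<omega> + g \<omega>)"
  using assms square_integrable_mult[OF assms]
  by (auto simp: square_integrable_def power2_sum mult.assoc)

lemma square_integrable_scale:
  "square_integrable M f \<Longrightarrow> square_integrable M (\<lambda>\<omega>. c * f \<omega>)"
  by (auto simp: square_integrable_def power_mult_distrib)

lemma square_integrable_zero: "square_integrable M (\<lambda>_. 0)"
  by (simp add: square_integrable_def)

lemma square_integrable_sum:
  "(\<And>i. i \<in> I \<Longrightarrow> square_integrable M (f i)) \<Longrightarrow> square_integrable M (\<lambda>\<omega>. \<Sum>i\<in>I. f i \<omega>)"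
  by (induction I rule: infinite_finite_induct) (auto simp: square_integrable_zero intro: square_integrable_add)

lemma uncorrelated_square_integrable:
  "uncorrelated M f g \<Longrightarrow> square_integrable M f" "uncorrelated M f g \<Longrightarrow> square_integrable M g"
  by (simp_all add: uncorrelated_def)

lemma uncorrelated_sym: "uncorrelated M f g \<Longrightarrow> uncorrelated M g f"
  by (simp add: uncorrelated_def mult.commute)

lemma uncorrelated_add:
  assumes "uncorrelated M f h" "uncorrelated M g h"
  shows "uncorrelated M (\<lambda>\<omega>. f \<omega> + g \<omega>) h"
  using assms
  by (auto simp: uncorrelated_def distrib_right square_integrable_mult intro: square_integrable_add)

lemma uncorrelated_scale: "uncorrelated M f h \<Longrightarrow> uncorrelated M (\<lambda>\<omega>. c * f \<omega>) h"
  by (auto simp: uncorrelated_def mult.assoc intro: square_integrable_scale)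

lemma uncorrelated_sum:
  assumes "square_integrable M h" "\<And>i. i \<in> I \<Longrightarrow> uncorrelated M (f i) h"
  shows "uncorrelated M (\<lambda>\<omega>. \<Sum>i\<in>I. f i \<omega>) h"
  using assms(2)
proof (induction I rule: infinite_finite_induct)
  case (insert i I)
  then show ?case
    by (auto intro: uncorrelated_add)
qed (auto simp: uncorrelated_def square_integrable_zero assms(1))

lemma mean_square_nonneg: "mean_square M f \<ge> 0"
  by (simp add: mean_square_def)

lemma mean_square_scale: "mean_square M (\<lambda>\<omega>. c * f \<omega>) = c\<^sup>2 * mean_square M f"
  by (simp add: mean_square_def power_mult_distrib)

lemma mean_square_add_uncorrelated:
  assumes "uncorrelated M f g"
  shows "mean_square M (\<lambda>\<omega>. f \<omega> + g \<omega>) = mean_square M f + mean_square M g"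
proof -
  have "integrable M (\<lambda>\<omega>. f \<omega> * g \<omega>)" "integrable M (\<lambda>\<omega>. (f \<omega>)\<^sup>2)" "integrable M (\<lambda>\<omega>. (g \<omega>)\<^sup>2)"
    "(LINT \<omega>|M. f \<omega> * g \<omega>) = 0"
    using assms square_integrable_mult by (auto simp: uncorrelated_def square_integrable_def)
  then show ?thesis
    by (simp add: mean_square_def power2_sum mult.assoc)
qed

section \<open>Second moments of random vectors\<close>

text \<open>Testing by linear functionals makes images under linear maps immediate: the map moves to
  the functional as its adjoint.\<close>

definition square_integrable_vec :: "'w measure \<Rightarrow> ('w \<Rightarrow> 'a::euclidean_space) \<Rightarrow> bool" where
  "square_integrable_vec M Y \<longleftrightarrow> (\<forall>a. square_integrable M (\<lambda>\<omega>. a \<bullet> Y \<omega>))"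

definition mean_square_norm :: "'w measure \<Rightarrow> ('w \<Rightarrow> 'a::euclidean_space) \<Rightarrow> real" where
  "mean_square_norm M Y = (LINT \<omega>|M. (norm (Y \<omega>))\<^sup>2)"

lemma norm_square_Basis: "(norm (y :: 'a::euclidean_space))\<^sup>2 = (\<Sum>b\<in>Basis. (b \<bullet> y)\<^sup>2)"
  unfolding power2_norm_eq_inner by (subst euclidean_inner) (simp add: power2_eq_square inner_commute)

lemma square_integrable_vec_integrable:
  "square_integrable_vec M Y \<Longrightarrow> integrable M (\<lambda>\<omega>. (norm (Y \<omega>))\<^sup>2)"
  unfolding norm_square_Basis
  by (intro Bochner_Integration.integrable_sum) (simp add: square_integrable_vec_def square_integrable_def)

lemma mean_square_norm_Basis:
  assumes "square_integrable_vec M Y"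
  shows "mean_square_norm M Y = (\<Sum>b\<in>Basis. mean_square M (\<lambda>\<omega>. b \<bullet> Y \<omega>))"
  using assms unfolding mean_square_norm_def norm_square_Basis mean_square_def
  by (subst Bochner_Integration.integral_sum) (auto simp: square_integrable_vec_def square_integrable_def)

lemma mean_square_norm_nonneg: "mean_square_norm M Y \<ge> 0"
  by (simp add: mean_square_norm_def)

lemma square_integrable_vec_add:
  "square_integrable_vec M Y \<Longrightarrow> square_integrable_vec M Q \<Longrightarrow> square_integrable_vec M (\<lambda>\<omega>. Y \<omega> + Q \<omega>)"
  by (simp add: square_integrable_vec_def inner_add_right square_integrable_add)

lemma square_integrable_vec_sum:
  "(\<And>i. i \<in> I \<Longrightarrow> square_integrable_vec M (Y i)) \<Longrightarrow> square_integrable_vec M (\<lambda>\<omega>. \<Sum>i\<in>I. Y i \<omega>)"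
  by (simp add: square_integrable_vec_def inner_sum_right square_integrable_sum)

lemma inner_linear_adjoint:
  fixes F :: "'a::euclidean_space \<Rightarrow> 'b::euclidean_space"
  assumes "linear F"
  shows "a \<bullet> F y = adjoint F a \<bullet> y"
  using adjoint_works[OF assms, of y a] by (simp add: inner_commute)

lemma square_integrable_vec_linear:
  assumes "linear F" "square_integrable_vec M Y"
  shows "square_integrable_vec M (\<lambda>\<omega>. F (Y \<omega>))"
  using assms(2) by (simp add: square_integrable_vec_def inner_linear_adjoint[OF assms(1)])

lemma square_integrable_vec_scaleR:
  assumes "square_integrable M f"
  shows "square_integrable_vec M (\<lambda>\<omega>. f \<omega> *\<^sub>R y)"
  using square_integrable_scale[OF assms] by (simp add: square_integrable_vec_def mult.commute[of "f _"])

lemma mean_square_norm_scaleR: "mean_square_norm M (\<lambda>\<omega>. f \<omega> *\<^sub>R y) = mean_square M f * (norm y)\<^sup>2"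
  by (simp add: mean_square_norm_def mean_square_def power_mult_distrib)

text \<open>Cauchy-Schwarz, with no uncorrelatedness required. The crude factor is affordable
  because sums never have more terms than a period has slots.\<close>

lemma mean_square_norm_sum_le:
  assumes "finite I" "\<And>i. i \<in> I \<Longrightarrow> square_integrable_vec M (Y i)"
  shows "mean_square_norm M (\<lambda>\<omega>. \<Sum>i\<in>I. Y i \<omega>) \<le> real (card I) * (\<Sum>i\<in>I. mean_square_norm M (Y i))"
proof -
  have int: "integrable M (\<lambda>\<omega>. (norm (Y i \<omega>))\<^sup>2)" if "i \<in> I" for i
    using assms(2)[OF that] by (rule square_integrable_vec_integrable)
  have "(norm (\<Sum>i\<in>I. Y i \<omega>))\<^sup>2 \<le> real (card I) * (\<Sum>i\<in>I. (norm (Y i \<omega>))\<^sup>2)" for \<omega>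
  proof -
    have "(norm (\<Sum>i\<in>I. Y i \<omega>))\<^sup>2 \<le> (\<Sum>i\<in>I. 1 * norm (Y i \<omega>))\<^sup>2"
      by (intro power_mono) (simp_all add: norm_sum)
    also have "\<dots> \<le> (\<Sum>i\<in>I. 1\<^sup>2) * (\<Sum>i\<in>I. (norm (Y i \<omega>))\<^sup>2)"
      by (rule Cauchy_Schwarz_ineq_sum)
    finally show ?thesis
      by simp
  qed
  then have "mean_square_norm M (\<lambda>\<omega>. \<Sum>i\<in>I. Y i \<omega>) \<le> (LINT \<omega>|M. real (card I) * (\<Sum>i\<in>I. (norm (Y i \<omega>))\<^sup>2))"
    unfolding mean_square_norm_def
    by (intro integral_mono square_integrable_vec_integrable square_integrable_vec_sum assms(2)
        integrable_mult_right Bochner_Integration.integrable_sum int) auto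
  also have "\<dots> = real (card I) * (\<Sum>i\<in>I. mean_square_norm M (Y i))"
    using int by (simp add: mean_square_norm_def Bochner_Integration.integral_sum)
  finally show ?thesis .
qed

lemma mean_square_norm_linear_bounded:
  fixes F :: "'a::euclidean_space \<Rightarrow> 'b::euclidean_space"
  assumes "linear F" and Y: "\<And>t. square_integrable_vec M (Y t)" and c: "\<And>t. mean_square_norm M (Y t) \<le> c"
  shows "\<exists>C. \<forall>t. mean_square_norm M (\<lambda>\<omega>. F (Y t \<omega>)) \<le> C"
proof -
  obtain b where b: "b > 0" "\<And>x. norm (F x) \<le> b * norm x"
    using linear_bounded_pos[OF assms(1)] by auto
  have "mean_square_norm M (\<lambda>\<omega>. F (Y t \<omega>)) \<le> b\<^sup>2 * c" for t
  proof -
    have "mean_square_norm M (\<lambda>\<omega>. F (Y t \<omega>)) \<le> (LINT \<omega>|M. b\<^sup>2 * (norm (Y t \<omega>))\<^sup>2)"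
      unfolding mean_square_norm_def
    proof (rule integral_mono)
      show "integrable M (\<lambda>\<omega>. (norm (F (Y t \<omega>)))\<^sup>2)" "integrable M (\<lambda>\<omega>. b\<^sup>2 * (norm (Y t \<omega>))\<^sup>2)"
        using Y square_integrable_vec_linear[OF assms(1) Y] square_integrable_vec_integrable by auto
      show "(norm (F (Y t \<omega>)))\<^sup>2 \<le> b\<^sup>2 * (norm (Y t \<omega>))\<^sup>2" for \<omega>
        using b(2)[of "Y t \<omega>"] by (simp add: power_mult_distrib[symmetric] power_mono)
    qed
    also have "\<dots> \<le> b\<^sup>2 * c"
      using c[of t] by (simp add: mean_square_norm_def mult_left_mono)
    finally show ?thesis .
  qed
  then show ?thesis
    by blast
qed

lemma orthonormal_expansion:
  fixes v :: "'n \<Rightarrow> real^'n"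
  assumes "\<And>i j. v i \<bullet> v j = (if i = j then 1 else 0)"
  shows "y = (\<Sum>i\<in>UNIV. (v i \<bullet> y) *\<^sub>R v i)"
    and "(\<chi> i. v i) ** transpose (\<chi> i. v i) = mat 1"
proof -
  define V where "V = (\<chi> i. v i)"
  show inv: "(\<chi> i. v i) ** transpose (\<chi> i. v i) = mat 1"
    using assms by (simp add: vec_eq_iff matrix_matrix_mult_def transpose_def inner_vec_def mat_def)
  then have "y = transpose V *v (V *v y)"
    unfolding V_def by (metis matrix_left_right_inverse matrix_vector_mul_assoc matrix_vector_mul_lid)
  also have "\<dots> = (\<Sum>i\<in>UNIV. (v i \<bullet> y) *\<^sub>R v i)"
    by (simp add: vec_eq_iff V_def matrix_vector_mult_def transpose_def inner_vec_def mult.commute)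
  finally show "y = (\<Sum>i\<in>UNIV. (v i \<bullet> y) *\<^sub>R v i)" .
qed

lemma norm_linear_right_singular:
  fixes v :: "'n \<Rightarrow> real^'n" and G :: "real^'n \<Rightarrow> 'b::euclidean_space"
  assumes "linear G" and v: "\<And>i j. v i \<bullet> v j = (if i = j then 1 else 0)"
    and Gv: "\<And>i j. i \<noteq> j \<Longrightarrow> G (v i) \<bullet> G (v j) = 0"
  shows "(norm (G y))\<^sup>2 = (\<Sum>i\<in>UNIV. (norm (G (v i)))\<^sup>2 * (v i \<bullet> y)\<^sup>2)"
proof -
  have "G y = (\<Sum>i\<in>UNIV. (v i \<bullet> y) *\<^sub>R G (v i))"
    by (subst orthonormal_expansion(1)[OF v, of y])
      (simp add: linear_sum[OF assms(1)] linear_cmul[OF assms(1)])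
  also have "(norm \<dots>)\<^sup>2 = (\<Sum>i\<in>UNIV. (norm ((v i \<bullet> y) *\<^sub>R G (v i)))\<^sup>2)"
    by (intro norm_sum_Pythagorean) (auto simp: pairwise_def orthogonal_def Gv)
  finally show ?thesis
    by (simp add: power_mult_distrib mult.commute)
qed

text \<open>Orthogonality of the images removes all cross terms, so correlations between the
  components of \<open>Y\<close> are irrelevant and n scalar second moments suffice.\<close>

lemma mean_square_norm_right_singular:
  fixes v :: "'n \<Rightarrow> real^'n" and G :: "real^'n \<Rightarrow> 'b::euclidean_space"
  assumes "linear G" "\<And>i j. v i \<bullet> v j = (if i = j then 1 else 0)"
    and "\<And>i j. i \<noteq> j \<Longrightarrow> G (v i) \<bullet> G (v j) = 0" and "square_integrable_vec M Y"
  shows "mean_square_norm M (\<lambda>\<omega>. G (Y \<omega>))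
    = (\<Sum>i\<in>UNIV. (norm (G (v i)))\<^sup>2 * mean_square M (\<lambda>\<omega>. v i \<bullet> Y \<omega>))"
proof -
  have "mean_square_norm M (\<lambda>\<omega>. G (Y \<omega>))
      = (LINT \<omega>|M. (\<Sum>i\<in>UNIV. (norm (G (v i)))\<^sup>2 * (v i \<bullet> Y \<omega>)\<^sup>2))"
    unfolding mean_square_norm_def
    by (intro Bochner_Integration.integral_cong refl norm_linear_right_singular assms(1-3))
  also have "\<dots> = (\<Sum>i\<in>UNIV. (norm (G (v i)))\<^sup>2 * mean_square M (\<lambda>\<omega>. v i \<bullet> Y \<omega>))"
    using assms(4) unfolding mean_square_def
    by (subst Bochner_Integration.integral_sum) (auto simp: square_integrable_vec_def square_integrable_def)
  finally show ?thesis .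
qed

lemma mean_square_norm_add_uncorrelated:
  assumes "\<And>a. uncorrelated M (\<lambda>\<omega>. a \<bullet> Y \<omega>) (\<lambda>\<omega>. a \<bullet> Q \<omega>)"
  shows "mean_square_norm M (\<lambda>\<omega>. Y \<omega> + Q \<omega>) = mean_square_norm M Y + mean_square_norm M Q"
proof -
  have "square_integrable_vec M Y" "square_integrable_vec M Q"
    using assms by (auto simp: square_integrable_vec_def uncorrelated_def)
  then show ?thesis
    by (simp add: mean_square_norm_Basis square_integrable_vec_add inner_add_right
        mean_square_add_uncorrelated assms sum.distrib)
qed

lemma mean_square_inner_le:
  assumes "norm a = 1" "square_integrable_vec M Y"
  shows "mean_square M (\<lambda>\<omega>. a \<bullet> Y \<omega>) \<le> mean_square_norm M Y"
  unfolding mean_square_def mean_square_norm_def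
proof (rule integral_mono)
  show "integrable M (\<lambda>\<omega>. (a \<bullet> Y \<omega>)\<^sup>2)" "integrable M (\<lambda>\<omega>. (norm (Y \<omega>))\<^sup>2)"
    using assms(2) square_integrable_vec_integrable by (auto simp: square_integrable_vec_def square_integrable_def)
  show "(a \<bullet> Y \<omega>)\<^sup>2 \<le> (norm (Y \<omega>))\<^sup>2" for \<omega>
    using Cauchy_Schwarz_ineq2[of a "Y \<omega>"] assms(1) by (simp add: abs_le_square_iff[symmetric])
qed

lemma mean_square_norm_add_bounded:
  assumes "\<And>k. square_integrable_vec M (Y k)" "\<And>k. square_integrable_vec M (Q k)"
    and "\<exists>C. \<forall>k. mean_square_norm M (Y k) \<le> C" "\<exists>C. \<forall>k. mean_square_norm M (Q k) \<le> C"
  shows "\<exists>C. \<forall>k. mean_square_norm M (\<lambda>\<omega>. Y k \<omega> + Q k \<omega>) \<le> C"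
proof -
  obtain C D where C: "\<And>k. mean_square_norm M (Y k) \<le> C" and D: "\<And>k. mean_square_norm M (Q k) \<le> D"
    using assms(3,4) by auto
  have "mean_square_norm M (\<lambda>\<omega>. Y k \<omega> + Q k \<omega>) \<le> 2 * (C + D)" for k
  proof -
    have "square_integrable_vec M (if i = (0 :: nat) then Y k else Q k)" for i
      using assms(1,2) by simp
    then show ?thesis
      using mean_square_norm_sum_le[of "{0, 1 :: nat}" M "\<lambda>i. if i = 0 then Y k else Q k"] C[of k] D[of k]
      by simp
  qed
  then show ?thesis
    by blast
qed

section \<open>The periodic transmission scheme\<close>

locale uncorrelated_noise =
  fixes M :: "'w measure" and X0 :: "'w \<Rightarrow> real^'n" and W :: "nat \<Rightarrow> 'w \<Rightarrow> real^'n"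
    and Z :: "nat \<Rightarrow> 'w \<Rightarrow> real" and N :: real
  assumes X0_Z: "uncorrelated M (\<lambda>\<omega>. a \<bullet> X0 \<omega>) (Z t)"
    and X0_W: "uncorrelated M (\<lambda>\<omega>. a \<bullet> X0 \<omega>) (\<lambda>\<omega>. b \<bullet> W t \<omega>)"
    and W_Z: "uncorrelated M (\<lambda>\<omega>. a \<bullet> W s \<omega>) (Z t)"
    and W_W: "s \<noteq> t \<Longrightarrow> uncorrelated M (\<lambda>\<omega>. a \<bullet> W s \<omega>) (\<lambda>\<omega>. b \<bullet> W t \<omega>)"
    and Z_Z: "s \<noteq> t \<Longrightarrow> uncorrelated M (Z s) (Z t)"
    and Z_variance: "mean_square M (Z t) = N"
    and W_stationary: "mean_square M (\<lambda>\<omega>. a \<bullet> W t \<omega>) = mean_square M (\<lambda>\<omega>. a \<bullet> W 0 \<omega>)"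
    and X0_nondegenerate: "a \<noteq> 0 \<Longrightarrow> mean_square M (\<lambda>\<omega>. a \<bullet> X0 \<omega>) > 0"

text \<open>The first \<open>q\<close> slots of a period transmit, the remaining n steer.
  \<open>j0\<close> is an arbitrary input coordinate, used to carry the copies of received values.
  The factor N / (P + N) is 1 / (1 + P / N).\<close>

locale periodic_scheme = uncorrelated_noise M X0 W Z N
  for M :: "'w measure" and X0 :: "'w \<Rightarrow> real^'n" and W :: "nat \<Rightarrow> 'w \<Rightarrow> real^'n"
    and Z :: "nat \<Rightarrow> 'w \<Rightarrow> real" and N :: real +
  fixes A :: "real^'n^'n" and B :: "real^'m^'n" and P :: real and L q :: nat
    and v :: "'n \<Rightarrow> real^'n" and sch :: "nat \<Rightarrow> 'n" and ctl :: "nat \<Rightarrow> real^'n \<Rightarrow> real^'m" and j0 :: 'm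
  assumes P_pos: "P > 0" and N_pos: "N > 0" and L: "L = q + CARD('n)"
    and v: "v i \<bullet> v j = (if i = j then 1 else 0)"
    and Gv: "i \<noteq> j \<Longrightarrow> ((*v) A ^^ L) (v i) \<bullet> ((*v) A ^^ L) (v j) = 0"
    and contraction: "(norm (((*v) A ^^ L) (v i)))\<^sup>2 * (N / (P + N)) ^ card {s. s < q \<and> sch s = i} \<le> 1 / 2"
    and G_inj: "((*v) A ^^ L) x = 0 \<Longrightarrow> x = 0"
    and ctl_linear: "linear (ctl l)"
    and ctl: "(\<Sum>j<CARD('n). ((*v) A ^^ j) (B *v ctl j z)) = z"
begin

abbreviation G :: "real^'n \<Rightarrow> real^'n" where "G \<equiv> (*v) A ^^ L"

abbreviation dir :: "nat \<Rightarrow> real^'n" where "dir t \<equiv> v (sch (t mod L))"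

abbreviation start :: "nat \<Rightarrow> nat" where "start t \<equiv> t - t mod L"

text \<open>Enters the error only at the last slot of a period, where t - j runs exactly through
  that period; the truncation of the subtraction for small t is then never met.\<close>

definition noise :: "nat \<Rightarrow> 'w \<Rightarrow> real^'n" where
  "noise t \<omega> = (\<Sum>j<L. ((*v) A ^^ j) (W (t - j) \<omega>))"

text \<open>The gain makes the transmit power exactly P; the correction is the linear least mean square
  estimate of the transmitted component from the received signal, per unit of that signal. A vanishing
  error variance, which would give the gain the junk value 0, never occurs.\<close>

definition gain_for :: "('w \<Rightarrow> real^'n) \<Rightarrow> nat \<Rightarrow> real" where
  "gain_for E t = sqrt (P / mean_square M (\<lambda>\<omega>. dir t \<bullet> E \<omega>))"

definition correction_for :: "('w \<Rightarrow> real^'n) \<Rightarrow> nat \<Rightarrow> real" where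
  "correction_for E t = (if t mod L < q then sqrt (P * mean_square M (\<lambda>\<omega>. dir t \<bullet> E \<omega>)) / (P + N) else 0)"

text \<open>The error of the estimate, at time t, of the state at the start of the current period. At the
  end of the period the controls have cancelled the estimated part of the state, so the new state
  is the propagated error plus the accumulated plant noise.\<close>

primrec err :: "nat \<Rightarrow> 'w \<Rightarrow> real^'n" where
  "err 0 = X0"
| "err (Suc t) = (\<lambda>\<omega>.
     let e = err t \<omega> -
           (correction_for (err t) t * (gain_for (err t) t * (dir t \<bullet> err t \<omega>) + Z t \<omega>)) *\<^sub>R dir t
     in if Suc t mod L = 0 then G e + noise t \<omega> else e)"

text \<open>The variants with a parameter \<open>E\<close> exist because the recursion for
  \<open>err\<close> computes its coefficients from the second moment of its own current
  value.\<close>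

definition gain :: "nat \<Rightarrow> real" where "gain t = gain_for (err t) t"

definition correction :: "nat \<Rightarrow> real" where "correction t = correction_for (err t) t"

definition signal :: "nat \<Rightarrow> 'w \<Rightarrow> real" where "signal t \<omega> = gain t * (dir t \<bullet> err t \<omega>)"

definition received :: "nat \<Rightarrow> 'w \<Rightarrow> real" where "received t \<omega> = signal t \<omega> + Z t \<omega>"

definition updated :: "nat \<Rightarrow> 'w \<Rightarrow> real^'n" where
  "updated t \<omega> = err t \<omega> - (correction t * received t \<omega>) *\<^sub>R dir t"

lemma L_pos: "0 < L" and q_less_L: "q < L"
  by (simp_all add: L)

lemma err_Suc: "err (Suc t) \<omega> = (if Suc t mod L = 0 then G (updated t \<omega>) + noise t \<omega> else updated t \<omega>)"
  by (simp add: updated_def received_def signal_def gain_def correction_def Let_def)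

declare err.simps(2) [simp del]

lemma linear_A_power: "linear ((*v) A ^^ j)"
  by (rule linear_funpow) simp

lemma Z_square_integrable: "square_integrable M (Z t)"
  using X0_Z by (rule uncorrelated_square_integrable)

lemma W_square_integrable: "square_integrable M (\<lambda>\<omega>. a \<bullet> W t \<omega>)"
  using W_Z by (rule uncorrelated_square_integrable)

lemma inner_updated:
  "a \<bullet> updated t \<omega> = (a - (correction t * gain t * (a \<bullet> dir t)) *\<^sub>R dir t) \<bullet> err t \<omega>
     + (- correction t * (a \<bullet> dir t)) * Z t \<omega>"
  by (simp add: updated_def received_def signal_def inner_simps algebra_simps)

lemma inner_noise: "a \<bullet> noise t \<omega> = (\<Sum>j<L. adjoint ((*v) A ^^ j) a \<bullet> W (t - j) \<omega>)"
  by (simp add: noise_def inner_sum_right inner_linear_adjoint[OF linear_A_power])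

lemma inner_err_reset:
  "Suc t mod L = 0 \<Longrightarrow> a \<bullet> err (Suc t) \<omega> = adjoint G a \<bullet> updated t \<omega> + a \<bullet> noise t \<omega>"
  by (simp add: err_Suc inner_add_right inner_linear_adjoint[OF linear_A_power])

lemma start_Suc: "Suc t mod L \<noteq> 0 \<Longrightarrow> start (Suc t) = start t"
  by (simp add: mod_Suc split: if_splits)

section \<open>Uncorrelatedness and second moments of the error\<close>

lemma noise_uncorrelated_Z: "uncorrelated M (\<lambda>\<omega>. a \<bullet> noise t \<omega>) (Z s)"
  unfolding inner_noise by (intro uncorrelated_sum W_Z Z_square_integrable)

lemma noise_uncorrelated_W: "t < s \<Longrightarrow> uncorrelated M (\<lambda>\<omega>. a \<bullet> noise t \<omega>) (\<lambda>\<omega>. b \<bullet> W s \<omega>)"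
  unfolding inner_noise by (intro uncorrelated_sum W_W W_square_integrable) auto

lemma updated_uncorrelated:
  assumes "\<And>a. uncorrelated M (\<lambda>\<omega>. a \<bullet> err t \<omega>) h" "uncorrelated M (Z t) h"
  shows "uncorrelated M (\<lambda>\<omega>. a \<bullet> updated t \<omega>) h"
  unfolding inner_updated by (intro uncorrelated_add uncorrelated_scale assms)

text \<open>For the plant noise the bound is \<open>start t\<close>, not t: the error refers to the
  state at the start of the period and contains no plant noise of that period yet. This makes the
  accumulated noise an uncorrelated summand at the reset.\<close>

lemma err_uncorrelated:
  "t \<le> s \<Longrightarrow> uncorrelated M (\<lambda>\<omega>. a \<bullet> err t \<omega>) (Z s)"
  "start t \<le> s \<Longrightarrow> uncorrelated M (\<lambda>\<omega>. a \<bullet> err t \<omega>) (\<lambda>\<omega>. b \<bullet> W s \<omega>)"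
proof (induction t arbitrary: a s b)
  case 0
  {
    case 1
    then show ?case by (simp add: X0_Z)
  next
    case 2
    then show ?case by (simp add: X0_W)
  }
next
  case (Suc t)
  {
    case 1
    have upd: "uncorrelated M (\<lambda>\<omega>. a \<bullet> updated t \<omega>) (Z s)" for a
      using 1 by (intro updated_uncorrelated Suc.IH Z_Z) auto
    show ?case
    proof (cases "Suc t mod L = 0")
      case True
      then show ?thesis
        unfolding inner_err_reset[OF True] by (intro uncorrelated_add upd noise_uncorrelated_Z)
    next
      case False
      then show ?thesis
        using upd by (simp add: err_Suc)
    qed
  next
    case 2
    show ?case
    proof (cases "Suc t mod L = 0")
      case True
      then have "t < s"
        using 2 by simp
      then show ?thesis
        unfolding inner_err_reset[OF True]
        by (intro uncorrelated_add updated_uncorrelated noise_uncorrelated_W Suc.IH W_Z[THEN uncorrelated_sym]) auto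
    next
      case False
      then have "start t \<le> s"
        using 2 start_Suc by simp
      then show ?thesis
        using False updated_uncorrelated[OF Suc.IH(2) W_Z[THEN uncorrelated_sym]] by (simp add: err_Suc)
    qed
  }
qed

lemma err_square_integrable: "square_integrable M (\<lambda>\<omega>. a \<bullet> err t \<omega>)"
  using err_uncorrelated(1)[OF order_refl] by (rule uncorrelated_square_integrable)

lemma err_square_integrable_vec: "square_integrable_vec M (err t)"
  by (simp add: square_integrable_vec_def err_square_integrable)

lemma updated_square_integrable: "square_integrable M (\<lambda>\<omega>. a \<bullet> updated t \<omega>)"
  unfolding inner_updated
  by (intro square_integrable_add square_integrable_scale err_square_integrable Z_square_integrable)

lemma updated_uncorrelated_noise:
  assumes "Suc t mod L = 0"
  shows "uncorrelated M (\<lambda>\<omega>. a \<bullet> updated t \<omega>) (\<lambda>\<omega>. b \<bullet> noise t \<omega>)"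
proof (rule uncorrelated_sym)
  have "start t \<le> t - j" if "j < L" for j
  proof -
    have "t mod L = L - 1"
      using assms L_pos by (auto simp: mod_Suc split: if_splits)
    then show ?thesis
      using that by simp
  qed
  then show "uncorrelated M (\<lambda>\<omega>. b \<bullet> noise t \<omega>) (\<lambda>\<omega>. a \<bullet> updated t \<omega>)"
    unfolding inner_noise
    by (intro uncorrelated_sum updated_square_integrable uncorrelated_sym[OF updated_uncorrelated]
        err_uncorrelated W_Z[THEN uncorrelated_sym]) auto
qed

lemma mean_square_updated:
  "mean_square M (\<lambda>\<omega>. a \<bullet> updated t \<omega>)
     = mean_square M (\<lambda>\<omega>. (a - (correction t * gain t * (a \<bullet> dir t)) *\<^sub>R dir t) \<bullet> err t \<omega>)
       + (correction t * (a \<bullet> dir t))\<^sup>2 * N"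
proof -
  have "uncorrelated M (\<lambda>\<omega>. b \<bullet> err t \<omega>) (\<lambda>\<omega>. c * Z t \<omega>)" for b c
    by (intro uncorrelated_sym[OF uncorrelated_scale] uncorrelated_sym[OF err_uncorrelated(1)] order_refl)
  then show ?thesis
    unfolding inner_updated
    by (simp only: mean_square_add_uncorrelated mean_square_scale Z_variance) (simp add: power_mult_distrib)
qed

lemma correction_gain_pos:
  assumes "mean_square M (\<lambda>\<omega>. dir t \<bullet> err t \<omega>) > 0"
  shows "correction t * gain t = (if t mod L < q then P / (P + N) else 0)"
  using assms P_pos
  by (simp add: correction_def correction_for_def gain_def gain_for_def real_sqrt_mult real_sqrt_divide)

text \<open>In a functional a, an update replaces a by (I - \<theta> d d^T) a, which is nonzero for
  nonzero a since \<theta> < 1, and adds uncorrelated noise; a reset applies the injective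
  \<open>G\<close>. That \<theta> is P / (P + N) or 0 itself depends on positivity at time t, so
  everything goes through one induction.\<close>

lemma err_nondegenerate: "a \<noteq> 0 \<Longrightarrow> mean_square M (\<lambda>\<omega>. a \<bullet> err t \<omega>) > 0"
proof (induction t arbitrary: a)
  case 0
  then show ?case by (simp add: X0_nondegenerate)
next
  case (Suc t)
  have upd: "mean_square M (\<lambda>\<omega>. a \<bullet> updated t \<omega>) > 0" if "a \<noteq> 0" for a
  proof -
    have "dir t \<noteq> 0"
      using v[of "sch (t mod L)" "sch (t mod L)"] by auto
    then obtain \<theta> where \<theta>: "correction t * gain t = \<theta>" "\<theta> < 1"
      using correction_gain_pos[of t] Suc.IH[of "dir t"] P_pos N_pos by (cases "t mod L < q") auto
    define b where "b = a - (\<theta> * (a \<bullet> dir t)) *\<^sub>R dir t"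
    have "b \<noteq> 0"
    proof
      assume "b = 0"
      then have a: "a = (\<theta> * (a \<bullet> dir t)) *\<^sub>R dir t"
        by (simp add: b_def)
      from arg_cong[OF a, of "\<lambda>x. x \<bullet> dir t"] have "a \<bullet> dir t = \<theta> * (a \<bullet> dir t)"
        by (simp add: v)
      then have "a \<bullet> dir t = 0"
        using \<theta>(2) by simp
      then show False
        using a that by simp
    qed
    then show ?thesis
      using Suc.IH[of b] N_pos unfolding mean_square_updated \<theta>(1) b_def[symmetric]
      by (simp add: add_pos_nonneg)
  qed
  show ?case
  proof (cases "Suc t mod L = 0")
    case True
    have "adjoint G a \<noteq> 0"
    proof
      assume "adjoint G a = 0"
      then have "a \<bullet> G x = 0" for x
        by (simp add: inner_linear_adjoint[OF linear_A_power])
      moreover have "surj G"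
        using linear_injective_imp_surjective[OF linear_A_power] linear_injective_0[OF linear_A_power] G_inj by auto
      ultimately have "a \<bullet> a = 0"
        by (metis surjD)
      then show False
        using Suc.prems by simp
    qed
    then show ?thesis
      unfolding inner_err_reset[OF True]
      using upd by (simp add: mean_square_add_uncorrelated updated_uncorrelated_noise[OF True] 
          add_pos_nonneg mean_square_nonneg)
  next
    case False
    then show ?thesis
      using upd[OF Suc.prems] by (simp add: err_Suc)
  qed
qed

lemma dir_variance_pos: "mean_square M (\<lambda>\<omega>. dir t \<bullet> err t \<omega>) > 0"
  using v[of "sch (t mod L)" "sch (t mod L)"] by (intro err_nondegenerate) auto

lemma signal_square_integrable: "square_integrable M (signal t)"
  unfolding signal_def[abs_def] by (intro square_integrable_scale err_square_integrable)

text \<open>True in every slot, including the steering slots, where a signal is sent although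
  nothing received is used; otherwise the average would fall below P.\<close>

lemma signal_power: "mean_square M (signal t) = P"
proof -
  have "mean_square M (signal t) = (gain t)\<^sup>2 * mean_square M (\<lambda>\<omega>. dir t \<bullet> err t \<omega>)"
    unfolding signal_def[abs_def] by (rule mean_square_scale)
  also have "(gain t)\<^sup>2 = P / mean_square M (\<lambda>\<omega>. dir t \<bullet> err t \<omega>)"
    using P_pos dir_variance_pos[of t] by (simp add: gain_def gain_for_def)
  finally show ?thesis
    using dir_variance_pos[of t] by simp
qed

lemma received_square_integrable: "square_integrable M (received t)"
  unfolding received_def[abs_def] by (intro square_integrable_add signal_square_integrable Z_square_integrable)

lemma received_power: "mean_square M (received t) = P + N"
proof -
  have "uncorrelated M (signal t) (Z t)"
    unfolding signal_def[abs_def] by (intro uncorrelated_scale err_uncorrelated) simp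
  then show ?thesis
    unfolding received_def[abs_def] by (simp add: mean_square_add_uncorrelated signal_power Z_variance)
qed

text \<open>Least mean square estimation leaves (1 - \<theta>)^2 s + (correction)^2 N = s N / (P +
  N) with \<theta> = P / (P + N). The update moves along \<open>dir t\<close>, which is orthogonal
  to the other \<open>v i\<close>, so those components stay exactly the same, even if correlated
  with the one sent.\<close>

lemma mean_square_updated_direction:
  "mean_square M (\<lambda>\<omega>. v i \<bullet> updated t \<omega>)
     = (if t mod L < q \<and> sch (t mod L) = i then N / (P + N) else 1) * mean_square M (\<lambda>\<omega>. v i \<bullet> err t \<omega>)"
proof (cases "sch (t mod L) = i")
  case True
  define s where "s = mean_square M (\<lambda>\<omega>. v i \<bullet> err t \<omega>)"
  have "s > 0"
    using dir_variance_pos[of t] True by (simp add: s_def)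
  have *: "mean_square M (\<lambda>\<omega>. v i \<bullet> updated t \<omega>) = (1 - correction t * gain t)\<^sup>2 * s + (correction t)\<^sup>2 * N"
  proof -
    have "v i - (correction t * gain t * (v i \<bullet> dir t)) *\<^sub>R dir t = (1 - correction t * gain t) *\<^sub>R v i"
      by (simp add: True v algebra_simps)
    then show ?thesis
      unfolding mean_square_updated by (simp add: True v s_def mean_square_scale)
  qed
  show ?thesis
  proof (cases "t mod L < q")
    case slot: True
    have "1 - correction t * gain t = N / (P + N)"
      using correction_gain_pos[OF dir_variance_pos] P_pos N_pos slot by (simp add: field_simps)
    moreover have "(correction t)\<^sup>2 = P * s / (P + N)\<^sup>2"
      using slot True P_pos \<open>s > 0\<close> by (simp add: correction_def correction_for_def power_divide s_def)
    ultimately have "mean_square M (\<lambda>\<omega>. v i \<bullet> updated t \<omega>) = (N\<^sup>2 * s + P * s * N) / (P + N)\<^sup>2"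
      unfolding * by (simp add: power_divide add_divide_distrib)
    also have "N\<^sup>2 * s + P * s * N = N * s * (P + N)"
      by (simp add: power2_eq_square algebra_simps)
    also have "N * s * (P + N) / (P + N)\<^sup>2 = N / (P + N) * s"
      using P_pos N_pos by (simp add: power2_eq_square)
    finally show ?thesis
      using True slot by (simp add: s_def)
  next
    case False
    then have "correction t = 0"
      by (simp add: correction_def correction_for_def)
    then show ?thesis
      unfolding * using False by (simp add: s_def)
  qed
next
  case False
  then show ?thesis
    unfolding mean_square_updated by (simp add: v)
qed

text \<open>Formulated for \<open>updated\<close> because \<open>err\<close> is already reset after
  the last slot. The minimum with \<open>q\<close> excludes steering slots from the count; at s = L
  - 1 it is the exponent of \<open>contraction\<close>.\<close>

lemma mean_square_updated_period:
  "s < L \<Longrightarrow> mean_square M (\<lambda>\<omega>. v i \<bullet> updated (k * L + s) \<omega>)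
     = (N / (P + N)) ^ card {r. r < min (Suc s) q \<and> sch r = i} * mean_square M (\<lambda>\<omega>. v i \<bullet> err (k * L) \<omega>)"
proof (induction s)
  case 0
  have "{r. r < min (Suc 0) q \<and> sch r = i} = (if 0 < q \<and> sch 0 = i then {0} else {})"
    by auto
  then show ?case
    using mean_square_updated_direction[of i "k * L"] by simp
next
  case (Suc s)
  have m: "(k * L + Suc s) mod L = Suc s"
    using Suc.prems by (simp only: mod_mult_self3 mod_less)
  then have err: "err (k * L + Suc s) = updated (k * L + s)"
    using m by (intro ext) (simp add: err_Suc)
  have "{r. r < min (Suc (Suc s)) q \<and> sch r = i}
      = (if Suc s < q \<and> sch (Suc s) = i then insert (Suc s) else id) {r. r < min (Suc s) q \<and> sch r = i}"
    by (auto simp: less_Suc_eq)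
  then have "card {r. r < min (Suc (Suc s)) q \<and> sch r = i}
      = (if Suc s < q \<and> sch (Suc s) = i then 1 else 0) + card {r. r < min (Suc s) q \<and> sch r = i}"
    by simp
  moreover have "mean_square M (\<lambda>\<omega>. v i \<bullet> updated (k * L + s) \<omega>)
      = (N / (P + N)) ^ card {r. r < min (Suc s) q \<and> sch r = i} * mean_square M (\<lambda>\<omega>. v i \<bullet> err (k * L) \<omega>)"
    using Suc by simp
  ultimately show ?case
    using mean_square_updated_direction[of i "k * L + Suc s"] unfolding m err
    by (cases "Suc s < q \<and> sch (Suc s) = i") (simp_all only: power_add if_True if_False simp_thms power_one_right power_0 mult_1_left mult.assoc)
qed

lemma W_square_integrable_vec: "square_integrable_vec M (W t)"
  by (simp add: square_integrable_vec_def W_square_integrable)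

lemma W_mean_square_norm: "mean_square_norm M (W t) = mean_square_norm M (W 0)"
  by (simp add: mean_square_norm_Basis W_square_integrable_vec W_stationary[of _ t])

lemma noise_bounded: "\<exists>C. \<forall>t. mean_square_norm M (noise t) \<le> C"
proof -
  have "\<exists>C. \<forall>t. mean_square_norm M (\<lambda>\<omega>. ((*v) A ^^ j) (W t \<omega>)) \<le> C" for j
    using linear_A_power W_square_integrable_vec W_mean_square_norm[THEN eq_refl]
    by (rule mean_square_norm_linear_bounded)
  then have "\<forall>j. \<exists>C. \<forall>t. mean_square_norm M (\<lambda>\<omega>. ((*v) A ^^ j) (W t \<omega>)) \<le> C"
    by blast
  from choice[OF this] obtain C where C: "\<forall>j t. mean_square_norm M (\<lambda>\<omega>. ((*v) A ^^ j) (W t \<omega>)) \<le> C j" ..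
  have "mean_square_norm M (noise t) \<le> real (card {..<L}) * (\<Sum>j<L. C j)" for t
  proof -
    have "mean_square_norm M (noise t) \<le> real (card {..<L}) * (\<Sum>j<L. mean_square_norm M (\<lambda>\<omega>. ((*v) A ^^ j) (W (t - j) \<omega>)))"
      unfolding noise_def[abs_def]
      by (rule mean_square_norm_sum_le)
        (auto intro: square_integrable_vec_linear[OF linear_A_power] W_square_integrable_vec)
    also have "\<dots> \<le> real (card {..<L}) * (\<Sum>j<L. C j)"
      by (intro mult_left_mono sum_mono C[rule_format]) auto
    finally show ?thesis .
  qed
  then show ?thesis by blast
qed

text \<open>Each component has been sent often enough to offset its squared singular value with a
  factor 1/2 to spare, and the plant noise adds without cross terms.\<close>

lemma mean_square_norm_reset:
  "mean_square_norm M (err (Suc k * L)) \<le> mean_square_norm M (err (k * L)) / 2 + mean_square_norm M (noise (k * L + (L - 1)))"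
proof -
  define t where "t = k * L + (L - 1)"
  have t: "Suc t = Suc k * L"
    using L_pos by (simp add: t_def)
  then have reset: "Suc t mod L = 0"
    by simp
  have "min (Suc (L - 1)) q = q"
    using q_less_L by simp
  have upd: "square_integrable_vec M (updated t)"
    by (simp add: square_integrable_vec_def updated_square_integrable)
  have "err (Suc k * L) = (\<lambda>\<omega>. G (updated t \<omega>) + noise t \<omega>)"
    unfolding t[symmetric] by (intro ext) (simp add: err_Suc[of t] reset)
  then have "mean_square_norm M (err (Suc k * L)) = mean_square_norm M (\<lambda>\<omega>. G (updated t \<omega>)) + mean_square_norm M (noise t)"
    using updated_uncorrelated_noise[OF reset]
    by (simp add: mean_square_norm_add_uncorrelated inner_linear_adjoint[OF linear_A_power])
  moreover have "mean_square_norm M (\<lambda>\<omega>. G (updated t \<omega>)) \<le> mean_square_norm M (err (k * L)) / 2"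
  proof -
    have "mean_square_norm M (\<lambda>\<omega>. G (updated t \<omega>))
        = (\<Sum>i\<in>UNIV. (norm (G (v i)))\<^sup>2 * mean_square M (\<lambda>\<omega>. v i \<bullet> updated t \<omega>))"
      by (rule mean_square_norm_right_singular[OF linear_A_power v Gv upd])
    also have "\<dots> \<le> (\<Sum>i\<in>UNIV. 1 / 2 * mean_square M (\<lambda>\<omega>. v i \<bullet> err (k * L) \<omega>))"
    proof (rule sum_mono)
      fix i
      have "(norm (G (v i)))\<^sup>2 * mean_square M (\<lambda>\<omega>. v i \<bullet> updated t \<omega>)
          = ((norm (G (v i)))\<^sup>2 * (N / (P + N)) ^ card {s. s < q \<and> sch s = i}) * mean_square M (\<lambda>\<omega>. v i \<bullet> err (k * L) \<omega>)"
        unfolding t_def using mean_square_updated_period[of "L - 1" i k] \<open>min (Suc (L - 1)) q = q\<close> L_pos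
        by simp
      also have "\<dots> \<le> 1 / 2 * mean_square M (\<lambda>\<omega>. v i \<bullet> err (k * L) \<omega>)"
        by (rule mult_right_mono[OF contraction mean_square_nonneg])
      finally show "(norm (G (v i)))\<^sup>2 * mean_square M (\<lambda>\<omega>. v i \<bullet> updated t \<omega>)
          \<le> 1 / 2 * mean_square M (\<lambda>\<omega>. v i \<bullet> err (k * L) \<omega>)" .
    qed
    also have "\<dots> = mean_square_norm M (err (k * L)) / 2"
    proof -
      have "norm (v i) = 1" for i
        using v[of i i] by (simp add: norm_eq_1)
      \<comment> \<open>Parseval: for the identity every orthonormal basis consists of right
        singular vectors.\<close>
      moreover have "mean_square_norm M (\<lambda>\<omega>. id (err (k * L) \<omega>))
          = (\<Sum>i\<in>UNIV. (norm (id (v i)))\<^sup>2 * mean_square M (\<lambda>\<omega>. v i \<bullet> err (k * L) \<omega>))"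
        by (rule mean_square_norm_right_singular[OF linear_id v _ err_square_integrable_vec]) (simp add: v)
      ultimately show ?thesis
        by (simp add: sum_divide_distrib)
    qed
    finally show ?thesis .
  qed
  ultimately show ?thesis
    by (simp add: t_def)
qed

lemma err_bounded_at_reset: "\<exists>C. \<forall>k. mean_square_norm M (err (k * L)) \<le> C"
proof -
  obtain C where C: "\<And>t. mean_square_norm M (noise t) \<le> C"
    using noise_bounded by blast
  \<comment> \<open>The value 2 C is the fixed point of x \<mapsto> x / 2 + C.\<close>
  have "mean_square_norm M (err (k * L)) \<le> mean_square_norm M (err 0) + 2 * C" for k
  proof (induction k)
    case 0
    then show ?case
      using C[of 0] mean_square_norm_nonneg[of M "noise 0"] by (simp del: err.simps)
  next
    case (Suc k)
    then show ?case
      using mean_square_norm_reset[of k] C[of "k * L + (L - 1)"] mean_square_norm_nonneg[of M "err 0"] by linarith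
  qed
  then show ?thesis by blast
qed

section \<open>Realization by an encoder and a controller\<close>

lemma err_within_period:
  "s < L \<Longrightarrow> err (k * L + s) \<omega>
     = err (k * L) \<omega> - (\<Sum>r<s. (correction (k * L + r) * received (k * L + r) \<omega>) *\<^sub>R dir (k * L + r))"
proof (induction s)
  case (Suc s)
  have "(k * L + Suc s) mod L = Suc s"
    using Suc.prems by (simp only: mod_mult_self3 mod_less)
  then have "err (k * L + Suc s) \<omega> = updated (k * L + s) \<omega>"
    by (simp add: err_Suc)
  also have "\<dots> = err (k * L + s) \<omega> - (correction (k * L + s) * received (k * L + s) \<omega>) *\<^sub>R dir (k * L + s)"
    by (rule updated_def)
  finally show ?case
    using Suc by simp
qed simp

text \<open>What the last controls of a period add to its terminal state per unit of R r: they cancel the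
  contribution of R r to the propagated estimate and the effect of the control that copies R r.\<close>

definition target :: "nat \<Rightarrow> real^'n" where
  "target r = - G (correction r *\<^sub>R dir r) - ((*v) A ^^ (L - 1 - r mod L)) (B *v axis j0 1)"

text \<open>A control at time t reaches the end of its period through A^j B with j = L - 1 - t mod
  L, which selects the member of the \<open>ctl\<close> family.\<close>

definition dec_coeff :: "nat \<Rightarrow> nat \<Rightarrow> real^'m" where
  "dec_coeff t s =
     (if t mod L < q then (if s = t then axis j0 1 else 0)
      else if start t \<le> s \<and> s < start t + q then ctl (L - 1 - t mod L) (target s) else 0)"

definition dec :: "'m controller" where
  "dec t r = (\<Sum>s\<le>t. r s *\<^sub>R dec_coeff t s)"

text \<open>In a transmitting slot the control is the received value times a unit vector, so this
  inner product recovers the correction made then. Orthonormality lets only slots with the current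
  direction contribute, and in steering slots the correction is 0.\<close>

definition enc_coeff :: "nat \<Rightarrow> nat \<Rightarrow> real^'m" where
  "enc_coeff t r =
     (if start t \<le> r \<and> sch (r mod L) = sch (t mod L) then correction r *\<^sub>R axis j0 1 else 0)"

definition enc :: "('n, 'm) encoder" where
  "enc t x u = gain t * (((\<chi> i. v i) *v x (start t)) $ sch (t mod L) - (\<Sum>r<t. enc_coeff t r \<bullet> u r))"

definition control :: "nat \<Rightarrow> 'w \<Rightarrow> real^'m" where
  "control t \<omega> = (\<Sum>s\<le>t. received s \<omega> *\<^sub>R dec_coeff t s)"

primrec state :: "nat \<Rightarrow> 'w \<Rightarrow> real^'n" where
  "state 0 = X0"
| "state (Suc t) = (\<lambda>\<omega>. A *v state t \<omega> + B *v control t \<omega> + W t \<omega>)"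

lemma control_transmit:
  assumes "t mod L < q"
  shows "control t \<omega> = received t \<omega> *\<^sub>R axis j0 1"
proof -
  have "control t \<omega> = (\<Sum>s\<in>{t}. received s \<omega> *\<^sub>R dec_coeff t s)"
    unfolding control_def using assms by (intro sum.mono_neutral_right) (auto simp: dec_coeff_def)
  then show ?thesis
    using assms by (simp add: dec_coeff_def)
qed

lemma control_deadbeat:
  assumes "q \<le> s" "s < L"
  shows "control (k * L + s) \<omega> = ctl (L - 1 - s) (\<Sum>r<q. received (k * L + r) \<omega> *\<^sub>R target (k * L + r))"
proof -
  have m: "(k * L + s) mod L = s"
    using assms by (simp only: mod_mult_self3 mod_less)
  have "control (k * L + s) \<omega> = (\<Sum>t\<in>{k * L..<k * L + q}. received t \<omega> *\<^sub>R ctl (L - 1 - s) (target t))"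
    unfolding control_def
    by (rule sum.mono_neutral_cong_right) (use assms m in \<open>auto simp: dec_coeff_def\<close>)
  also have "\<dots> = (\<Sum>r<q. received (k * L + r) \<omega> *\<^sub>R ctl (L - 1 - s) (target (k * L + r)))"
    by (rule sum.reindex_bij_witness[of _ "\<lambda>r. k * L + r" "\<lambda>t. t - k * L"]) auto
  also have "\<dots> = ctl (L - 1 - s) (\<Sum>r<q. received (k * L + r) \<omega> *\<^sub>R target (k * L + r))"
    by (simp add: linear_sum[OF ctl_linear] linear_cmul[OF ctl_linear])
  finally show ?thesis .
qed

lemma state_iterate:
  "state (t + m) \<omega> = ((*v) A ^^ m) (state t \<omega>)
     + (\<Sum>j<m. ((*v) A ^^ j) (B *v control (t + (m - 1 - j)) \<omega> + W (t + (m - 1 - j)) \<omega>))"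
proof (induction m)
  case (Suc m)
  define y where "y s = B *v control (t + s) \<omega> + W (t + s) \<omega>" for s
  have "(\<Sum>j<Suc m. ((*v) A ^^ j) (y (m - j))) = y m + A *v (\<Sum>j<m. ((*v) A ^^ j) (y (m - 1 - j)))"
    by (subst sum.lessThan_Suc_shift) (simp add: linear_sum[OF matrix_vector_mul_linear])
  moreover have "state (t + Suc m) \<omega> = A *v state (t + m) \<omega> + y m"
    by (simp add: y_def)
  ultimately show ?case
    using Suc by (simp add: y_def matrix_vector_right_distrib)
qed simp

text \<open>The link between the abstract recursion and the plant: over a period the controls
  contribute exactly -G of the estimate, and the estimate is the initial error minus the final
  one.\<close>

lemma state_at_reset: "state (k * L) \<omega> = err (k * L) \<omega>"
proof (induction k)
  case (Suc k)
  define t where "t = k * L + (L - 1)"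
  have t: "Suc t = Suc k * L"
    using L_pos by (simp add: t_def)
  define r where "r s = received (k * L + s) \<omega>" for s
  define z where "z = (\<Sum>s<q. r s *\<^sub>R target (k * L + s))"
  have mod: "(k * L + s) mod L = s" if "s < L" for s
    using that by (simp only: mod_mult_self3 mod_less)
  have slots: "{..<L} = {..<CARD('n)} \<union> {CARD('n)..<L}"
    using L by auto
  have "(\<Sum>j<L. ((*v) A ^^ j) (B *v control (k * L + (L - 1 - j)) \<omega>))
      = (\<Sum>j<CARD('n). ((*v) A ^^ j) (B *v control (k * L + (L - 1 - j)) \<omega>))
        + (\<Sum>j\<in>{CARD('n)..<L}. ((*v) A ^^ j) (B *v control (k * L + (L - 1 - j)) \<omega>))"
    unfolding slots by (rule sum.union_disjoint) auto
  also have "(\<Sum>j<CARD('n). ((*v) A ^^ j) (B *v control (k * L + (L - 1 - j)) \<omega>))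
      = (\<Sum>j<CARD('n). ((*v) A ^^ j) (B *v ctl j z))"
  proof (rule sum.cong[OF refl])
    fix j assume j: "j \<in> {..<CARD('n)}"
    then have "q \<le> L - 1 - j" "L - 1 - j < L" "L - 1 - (L - 1 - j) = j"
      using L by auto
    then show "((*v) A ^^ j) (B *v control (k * L + (L - 1 - j)) \<omega>) = ((*v) A ^^ j) (B *v ctl j z)"
      using control_deadbeat[of "L - 1 - j" k \<omega>] by (simp add: z_def r_def)
  qed
  also have "\<dots> = z"
    by (rule ctl)
  also have "(\<Sum>j\<in>{CARD('n)..<L}. ((*v) A ^^ j) (B *v control (k * L + (L - 1 - j)) \<omega>))
      = (\<Sum>s<q. ((*v) A ^^ (L - 1 - s)) (B *v control (k * L + s) \<omega>))"
    by (rule sum.reindex_bij_witness[of _ "\<lambda>s. L - 1 - s" "\<lambda>j. L - 1 - j"]) (auto simp: L)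
  also have "\<dots> = (\<Sum>s<q. r s *\<^sub>R ((*v) A ^^ (L - 1 - s)) (B *v axis j0 1))"
    by (intro sum.cong refl)
      (use q_less_L in \<open>simp add: control_transmit mod r_def matrix_vector_mult_scaleR linear_cmul[OF linear_A_power]\<close>)
  \<comment> \<open>The second part of each \<open>target\<close> cancels the propagated copy of the
    same received value, leaving its first part.\<close>
  also have "z + \<dots> = - G (\<Sum>s<q. (correction (k * L + s) * r s) *\<^sub>R dir (k * L + s))"
    unfolding z_def sum.distrib[symmetric] linear_sum[OF linear_A_power] sum_negf[symmetric]
    by (intro sum.cong refl)
      (use q_less_L in \<open>simp add: target_def mod linear_cmul[OF linear_A_power] algebra_simps\<close>)
  \<comment> \<open>Steering slots may be included because their correction is 0.\<close>
  also have "(\<Sum>s<q. (correction (k * L + s) * r s) *\<^sub>R dir (k * L + s))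
      = (\<Sum>s<L. (correction (k * L + s) * r s) *\<^sub>R dir (k * L + s))"
    by (rule sum.mono_neutral_left) (use q_less_L mod in \<open>auto simp: correction_def correction_for_def\<close>)
  also have "\<dots> = err (k * L) \<omega> - updated t \<omega>"
  proof -
    have "{..<L} = {..<Suc (L - 1)}"
      using L_pos by simp
    moreover have "err t \<omega> = err (k * L) \<omega> - (\<Sum>s<L - 1. (correction (k * L + s) * r s) *\<^sub>R dir (k * L + s))"
      unfolding t_def r_def using L_pos by (intro err_within_period) simp
    moreover have "updated t \<omega> = err t \<omega> - (correction (k * L + (L - 1)) * r (L - 1)) *\<^sub>R dir (k * L + (L - 1))"
      unfolding t_def r_def by (rule updated_def)
    ultimately show ?thesis
      by (simp only: sum.lessThan_Suc) (simp only: algebra_simps)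
  qed
  finally have "(\<Sum>j<L. ((*v) A ^^ j) (B *v control (k * L + (L - 1 - j)) \<omega>)) = - G (err (k * L) \<omega> - updated t \<omega>)" .
  moreover have "(\<Sum>j<L. ((*v) A ^^ j) (W (k * L + (L - 1 - j)) \<omega>)) = noise t \<omega>"
    unfolding noise_def by (intro sum.cong refl) (simp add: t_def)
  moreover have "state (k * L + L) \<omega> = G (state (k * L) \<omega>)
      + (\<Sum>j<L. ((*v) A ^^ j) (B *v control (k * L + (L - 1 - j)) \<omega>))
      + (\<Sum>j<L. ((*v) A ^^ j) (W (k * L + (L - 1 - j)) \<omega>))"
    unfolding state_iterate by (simp add: linear_add[OF linear_A_power] sum.distrib)
  ultimately have "state (k * L + L) \<omega> = G (updated t \<omega>) + noise t \<omega>"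
    using Suc by (simp add: linear_diff[OF linear_A_power])
  moreover have "err (Suc k * L) \<omega> = G (updated t \<omega>) + noise t \<omega>"
    unfolding t[symmetric] err_Suc using t by simp
  ultimately show ?case
    by (simp add: add.commute)
qed simp

lemma enc_signal:
  "enc t (\<lambda>s\<in>{..t}. state s \<omega>) (\<lambda>s\<in>{..<t}. control s \<omega>) = signal t \<omega>"
proof -
  define k s where "k = t div L" and "s = t mod L"
  have t: "t = k * L + s" and s: "s < L" and start: "start t = k * L"
    using L_pos by (simp_all add: k_def s_def minus_mod_eq_div_mult)
  have mod: "(k * L + r) mod L = r" if "r < L" for r
    using that by (simp only: mod_mult_self3 mod_less)
  have "(\<Sum>r<t. enc_coeff t r \<bullet> (\<lambda>s\<in>{..<t}. control s \<omega>) r) = (\<Sum>r<t. enc_coeff t r \<bullet> control r \<omega>)"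
    by (intro sum.cong) auto
  also have "\<dots> = (\<Sum>r\<in>{k * L..<k * L + s}. enc_coeff t r \<bullet> control r \<omega>)"
    by (rule sum.mono_neutral_right) (auto simp: enc_coeff_def start[simplified] t[symmetric])
  also have "\<dots> = (\<Sum>r<s. enc_coeff t (k * L + r) \<bullet> control (k * L + r) \<omega>)"
    by (rule sum.reindex_bij_witness[of _ "\<lambda>r. k * L + r" "\<lambda>t. t - k * L"]) auto
  also have "\<dots> = (\<Sum>r<s. dir t \<bullet> ((correction (k * L + r) * received (k * L + r) \<omega>) *\<^sub>R dir (k * L + r)))"
  proof (rule sum.cong[OF refl])
    fix r assume "r \<in> {..<s}"
    then have r: "(k * L + r) mod L = r"
      using s mod by simp
    show "enc_coeff t (k * L + r) \<bullet> control (k * L + r) \<omega>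
        = dir t \<bullet> ((correction (k * L + r) * received (k * L + r) \<omega>) *\<^sub>R dir (k * L + r))"
    proof (cases "r < q")
      case True
      then show ?thesis
        using r control_transmit[of "k * L + r" \<omega>]
        by (auto simp: enc_coeff_def start[simplified] v inner_axis_axis)
    next
      case False
      then have "correction (k * L + r) = 0"
        using r by (simp add: correction_def correction_for_def)
      then show ?thesis
        by (simp add: enc_coeff_def)
    qed
  qed
  finally have "(\<Sum>r<t. enc_coeff t r \<bullet> (\<lambda>s\<in>{..<t}. control s \<omega>) r)
      = dir t \<bullet> err (k * L) \<omega> - dir t \<bullet> err t \<omega>"
    using err_within_period[OF s, of k \<omega>] unfolding t[symmetric] by (simp add: inner_diff_right inner_sum_right)
  moreover have "((\<chi> i. v i) *v (\<lambda>s\<in>{..t}. state s \<omega>) (start t)) $ sch (t mod L) = dir t \<bullet> err (k * L) \<omega>"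
  proof -
    have "(\<lambda>s\<in>{..t}. state s \<omega>) (start t) = err (k * L) \<omega>"
      using state_at_reset[of k \<omega>] by (simp add: start[simplified] t[symmetric] diff_le_self[of t "t mod L", unfolded start])
    then show ?thesis
      by (simp add: matrix_vector_mult_def inner_vec_def)
  qed
  ultimately show ?thesis
    by (simp add: enc_def signal_def)
qed

section \<open>Formal properties of the policy\<close>

lemma dec_control: "dec t (\<lambda>s\<in>{..t}. received s \<omega>) = control t \<omega>"
  unfolding dec_def control_def by (intro sum.cong) auto

lemma closed_loop_scheme: "closed_loop M A B X0 W Z enc dec state control signal received"
  by (simp add: closed_loop_def enc_signal dec_control) (simp add: received_def)

lemma linear_policy_scheme: "linear_policy enc dec"
proof -
  have "\<exists>a b. \<forall>x u. enc t x u = (\<Sum>s\<le>t. a s \<bullet> x s) + (\<Sum>s<t. b s \<bullet> u s)" for t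
  proof (intro exI allI)
    fix x :: "nat \<Rightarrow> real^'n" and u :: "nat \<Rightarrow> real^'m"
    have "(\<Sum>s\<le>t. (if s = start t then gain t *\<^sub>R dir t else 0) \<bullet> x s)
        = (\<Sum>s\<in>{start t}. (if s = start t then gain t *\<^sub>R dir t else 0) \<bullet> x s)"
      by (rule sum.mono_neutral_right) auto
    moreover have "((\<chi> i. v i) *v x (start t)) $ sch (t mod L) = dir t \<bullet> x (start t)"
      by (simp add: matrix_vector_mult_def inner_vec_def)
    ultimately show "enc t x u = (\<Sum>s\<le>t. (if s = start t then gain t *\<^sub>R dir t else 0) \<bullet> x s)
        + (\<Sum>s<t. (- gain t *\<^sub>R enc_coeff t s) \<bullet> u s)"
      by (simp add: enc_def right_diff_distrib sum_distrib_left sum_negf)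
  qed
  then show ?thesis
    unfolding linear_policy_def dec_def by blast
qed

lemma sequential_scalar_encoding_scheme: "sequential_scalar_encoding enc"
proof -
  have "invertible (\<chi> i. v i)"
    using orthonormal_expansion(2)[OF v] by (metis invertible_right_inverse)
  moreover have "\<exists>s\<le>t. \<exists>i c d. \<forall>x u. enc t x u = c * (((\<chi> i. v i) *v x s) $ i - (\<Sum>r<t. d r \<bullet> u r))" for t
    unfolding enc_def
    by (rule exI[of _ "start t"], rule conjI, simp, rule exI[of _ "sch (t mod L)"], rule exI[of _ "gain t"],
        rule exI[of _ "enc_coeff t"]) simp
  ultimately show ?thesis
    unfolding sequential_scalar_encoding_def by blast
qed

lemma measurable_policy_scheme: "measurable_policy enc dec"
proof -
  have "case_prod (enc t) \<in> borel_measurable ((\<Pi>\<^sub>M s\<in>{..t}. borel) \<Otimes>\<^sub>M (\<Pi>\<^sub>M s\<in>{..<t}. borel))" for t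
  proof -
    have x: "(\<lambda>p. (fst p) s) \<in> borel_measurable ((\<Pi>\<^sub>M s\<in>{..t}. borel) \<Otimes>\<^sub>M (\<Pi>\<^sub>M s\<in>{..<t}. borel))"
      if "s \<le> t" for s
      using that by (intro measurable_compose[OF measurable_fst measurable_component_singleton]) simp
    have u: "(\<lambda>p. (snd p) s) \<in> borel_measurable ((\<Pi>\<^sub>M s\<in>{..t}. borel) \<Otimes>\<^sub>M (\<Pi>\<^sub>M s\<in>{..<t}. borel))"
      if "s < t" for s
      using that by (intro measurable_compose[OF measurable_snd measurable_component_singleton]) simp
    have T: "(\<lambda>y. ((\<chi> i. v i) *v y) $ sch (t mod L)) \<in> borel_measurable borel"
      by (intro borel_measurable_continuous_onI continuous_intros)
    show ?thesis
      unfolding enc_def case_prod_beta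
      by (intro borel_measurable_times borel_measurable_const borel_measurable_diff borel_measurable_sum
          borel_measurable_inner measurable_compose[OF x T] u) auto
  qed
  moreover have "dec t \<in> borel_measurable (\<Pi>\<^sub>M s\<in>{..t}. borel)" for t
    unfolding dec_def[abs_def]
    by (intro borel_measurable_sum borel_measurable_scaleR borel_measurable_const measurable_component_singleton) auto
  ultimately show ?thesis
    by (simp add: measurable_policy_def)
qed

lemma average_transmit_power_scheme: "average_transmit_power M signal P"
proof -
  have "integrable M (\<lambda>\<omega>. (signal t \<omega>)\<^sup>2)" for t
    using signal_square_integrable by (simp add: square_integrable_def)
  moreover have "(LINT \<omega>|M. (signal t \<omega>)\<^sup>2) = P" for t
    using signal_power by (simp add: mean_square_def)
  moreover have "(\<lambda>T. (\<Sum>t<T. P) / real T) \<longlonglongrightarrow> P"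
    by (rule tendsto_eventually, rule eventually_sequentiallyI[of 1]) simp
  ultimately show ?thesis
    by (simp add: average_transmit_power_def)
qed

section \<open>Mean square boundedness between resets\<close>

text \<open>The correction scales with the root of the error variance. Inside a period that variance
  never exceeds its value at the start, which is bounded over all periods. The bound is needed
  because the steering controls contain the corrections as coefficients.\<close>

lemma correction_bounded: "\<exists>C. \<forall>t. \<bar>correction t\<bar> \<le> C"
proof -
  obtain C where C: "\<And>k. mean_square_norm M (err (k * L)) \<le> C"
    using err_bounded_at_reset by auto
  have "\<bar>correction t\<bar> \<le> sqrt (P * C) / (P + N)" for t
  proof -
    define k s where "k = t div L" and "s = t mod L"
    have t: "t = k * L + s" and s: "s < L"
      using L_pos by (simp_all add: k_def s_def)
    have "mean_square M (\<lambda>\<omega>. v i \<bullet> err t \<omega>) \<le> mean_square M (\<lambda>\<omega>. v i \<bullet> err (k * L) \<omega>)" for i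
    proof (cases s)
      case (Suc l)
      have "(k * L + Suc l) mod L \<noteq> 0"
        using s unfolding Suc by (simp only: mod_mult_self3 mod_less)
      then have "err t = updated (k * L + l)"
        unfolding t Suc by (intro ext) (simp add: err_Suc)
      moreover have "(N / (P + N)) ^ card {r. r < min (Suc l) q \<and> sch r = i} \<le> 1"
        using P_pos N_pos by (intro power_le_one) auto
      ultimately show ?thesis
        using mean_square_updated_period[of l i k] s Suc
        by (simp add: mult_left_le_one_le[OF mean_square_nonneg] P_pos N_pos less_imp_le)
    qed (simp add: t)
    also have "mean_square M (\<lambda>\<omega>. v i \<bullet> err (k * L) \<omega>) \<le> C" for i
      using mean_square_inner_le[OF _ err_square_integrable_vec, of "v i" "k * L"] C[of k] v[of i i]
      by (simp add: norm_eq_1)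
    finally have "P * mean_square M (\<lambda>\<omega>. dir t \<bullet> err t \<omega>) \<le> P * C"
      using P_pos by simp
    moreover have "0 \<le> P * mean_square M (\<lambda>\<omega>. dir t \<bullet> err t \<omega>)"
      using P_pos by (simp add: mean_square_nonneg)
    moreover from calculation have "0 \<le> P * C"
      by linarith
    ultimately show ?thesis
      using P_pos N_pos by (auto simp: correction_def correction_for_def abs_mult divide_right_mono)
  qed
  then show ?thesis
    by blast
qed

lemma target_bounded: "\<exists>C. \<forall>t. norm (target t) \<le> C"
proof -
  obtain b where b: "b > 0" "\<And>x. norm (G x) \<le> b * norm x"
    using linear_bounded_pos[OF linear_A_power] by auto
  obtain C where C: "\<And>t. \<bar>correction t\<bar> \<le> C"
    using correction_bounded by auto
  define D where "D = (\<Sum>j<L. norm (((*v) A ^^ j) (B *v axis j0 1)))"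
  have "norm (target t) \<le> b * C + D" for t
  proof -
    have "norm (dir t) = 1"
      using v[of "sch (t mod L)" "sch (t mod L)"] by (simp add: norm_eq_1)
    then have "norm (G (correction t *\<^sub>R dir t)) \<le> b * \<bar>correction t\<bar>"
      using b(2)[of "correction t *\<^sub>R dir t"] by simp
    also have "\<dots> \<le> b * C"
      using b(1) C by simp
    finally have "norm (G (correction t *\<^sub>R dir t)) \<le> b * C" .
    moreover have "norm (((*v) A ^^ (L - 1 - t mod L)) (B *v axis j0 1)) \<le> D"
      unfolding D_def using L_pos by (intro member_le_sum) auto
    ultimately show ?thesis
      using norm_triangle_ineq4[of "- G (correction t *\<^sub>R dir t)" "((*v) A ^^ (L - 1 - t mod L)) (B *v axis j0 1)"]
      unfolding target_def by simp
  qed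
  then show ?thesis
    by blast
qed

lemma control_square_integrable_vec: "square_integrable_vec M (control t)"
  unfolding control_def[abs_def]
  by (intro square_integrable_vec_sum square_integrable_vec_scaleR received_square_integrable)

text \<open>A transmitting slot applies a received value of power P + N; a steering slot applies a
  combination of \<open>q\<close> such values with uniformly bounded coefficients.\<close>

lemma control_bounded_slot:
  assumes "s < L"
  shows "\<exists>C. \<forall>k. mean_square_norm M (control (k * L + s)) \<le> C"
proof (cases "s < q")
  case True
  have "control (k * L + s) = (\<lambda>\<omega>. received (k * L + s) \<omega> *\<^sub>R axis j0 1)" for k
  proof
    have "(k * L + s) mod L = s"
      using assms by (simp only: mod_mult_self3 mod_less)
    then show "control (k * L + s) \<omega> = received (k * L + s) \<omega> *\<^sub>R axis j0 1" for \<omega>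
      using True by (simp add: control_transmit)
  qed
  then show ?thesis
    by (auto simp: mean_square_norm_scaleR received_power)
next
  case False
  obtain b where b: "b > 0" "\<And>x. norm (ctl (L - 1 - s) x) \<le> b * norm x"
    using linear_bounded_pos[OF ctl_linear] by blast
  obtain C where C: "\<And>t. norm (target t) \<le> C"
    using target_bounded by auto
  have bound: "(norm (ctl (L - 1 - s) (target t)))\<^sup>2 \<le> (b * C)\<^sup>2" for t
  proof (rule power_mono)
    show "norm (ctl (L - 1 - s) (target t)) \<le> b * C"
      using b(2)[of "target t"] C[of t] b(1) by (meson mult_left_mono less_imp_le order_trans)
  qed simp
  have "mean_square_norm M (control (k * L + s)) \<le> real (card {..<q}) * (\<Sum>r<q. (P + N) * (b * C)\<^sup>2)" for k
  proof -
    have "control (k * L + s) = (\<lambda>\<omega>. \<Sum>r<q. received (k * L + r) \<omega> *\<^sub>R ctl (L - 1 - s) (target (k * L + r)))"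
      using False assms
      by (intro ext) (simp add: control_deadbeat linear_sum[OF ctl_linear] linear_cmul[OF ctl_linear])
    then have "mean_square_norm M (control (k * L + s)) \<le> real (card {..<q})
        * (\<Sum>r<q. mean_square_norm M (\<lambda>\<omega>. received (k * L + r) \<omega> *\<^sub>R ctl (L - 1 - s) (target (k * L + r))))"
      by (simp only:) (intro mean_square_norm_sum_le square_integrable_vec_scaleR received_square_integrable finite_lessThan)
    also have "\<dots> \<le> real (card {..<q}) * (\<Sum>r<q. (P + N) * (b * C)\<^sup>2)"
      unfolding mean_square_norm_scaleR received_power using P_pos N_pos
      by (intro mult_left_mono sum_mono bound) auto
    finally show ?thesis .
  qed
  then show ?thesis
    by blast
qed

lemma state_square_integrable_vec: "square_integrable_vec M (state t)"
proof (induction t)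
  case 0
  show ?case
    using err_square_integrable_vec[of 0] by simp
next
  case (Suc t)
  show ?case
    unfolding state.simps
    by (intro square_integrable_vec_add W_square_integrable_vec
        square_integrable_vec_linear[OF matrix_vector_mul_linear Suc]
        square_integrable_vec_linear[OF matrix_vector_mul_linear control_square_integrable_vec])
qed

text \<open>Between resets the plant may expand, but only over at most \<open>L\<close> steps with
  bounded inputs, so the bound at the resets is lost only by a constant for each slot.\<close>

lemma state_bounded_slot: "s \<le> L \<Longrightarrow> \<exists>C. \<forall>k. mean_square_norm M (state (k * L + s)) \<le> C"
proof (induction s)
  case 0
  have "state (k * L) = err (k * L)" for k
    by (intro ext state_at_reset)
  then show ?case
    using err_bounded_at_reset by simp
next
  case (Suc s)
  note linear_vec = square_integrable_vec_linear[OF matrix_vector_mul_linear]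
  obtain C where C: "\<And>k. mean_square_norm M (state (k * L + s)) \<le> C"
    using Suc by auto
  obtain D where D: "\<And>k. mean_square_norm M (control (k * L + s)) \<le> D"
    using control_bounded_slot[OF Suc_le_lessD[OF Suc.prems]] by blast
  have "\<exists>C. \<forall>k. mean_square_norm M (\<lambda>\<omega>. A *v state (k * L + s) \<omega>) \<le> C"
    using matrix_vector_mul_linear state_square_integrable_vec C by (rule mean_square_norm_linear_bounded)
  moreover have "\<exists>C. \<forall>k. mean_square_norm M (\<lambda>\<omega>. B *v control (k * L + s) \<omega>) \<le> C"
    using matrix_vector_mul_linear control_square_integrable_vec D by (rule mean_square_norm_linear_bounded)
  ultimately have "\<exists>C. \<forall>k. mean_square_norm M (\<lambda>\<omega>. A *v state (k * L + s) \<omega> + B *v control (k * L + s) \<omega>) \<le> C"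
    by (rule mean_square_norm_add_bounded[OF linear_vec[OF state_square_integrable_vec]
            linear_vec[OF control_square_integrable_vec]])
  moreover have "\<exists>C. \<forall>k. mean_square_norm M (W (k * L + s)) \<le> C"
    using W_mean_square_norm[THEN eq_refl] by blast
  ultimately have "\<exists>C. \<forall>k. mean_square_norm M
      (\<lambda>\<omega>. (A *v state (k * L + s) \<omega> + B *v control (k * L + s) \<omega>) + W (k * L + s) \<omega>) \<le> C"
    by (rule mean_square_norm_add_bounded[OF square_integrable_vec_add[OF linear_vec[OF state_square_integrable_vec]
            linear_vec[OF control_square_integrable_vec]] W_square_integrable_vec])
  then show ?case
    by simp
qed

lemma mean_square_stable_scheme: "mean_square_stable M state"
proof -
  obtain C where C: "\<forall>s. s \<le> L \<longrightarrow> (\<forall>k. mean_square_norm M (state (k * L + s)) \<le> C s)"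
    using state_bounded_slot by metis
  have "mean_square_norm M (state t) < 1 + (\<Sum>s<L. \<bar>C s\<bar>)" for t
  proof -
    have "t mod L \<le> L"
      using L_pos by (simp add: less_imp_le)
    then have "mean_square_norm M (state ((t div L) * L + t mod L)) \<le> C (t mod L)"
      using C by blast
    moreover have "\<bar>C (t mod L)\<bar> \<le> (\<Sum>s<L. \<bar>C s\<bar>)"
      using L_pos by (intro member_le_sum) auto
    ultimately show ?thesis
      by simp
  qed
  then show ?thesis
    using square_integrable_vec_integrable[OF state_square_integrable_vec]
    unfolding mean_square_stable_def mean_square_norm_def by blast
qed

lemma mean_square_stabilizes_scheme: "mean_square_stabilizes M A B X0 W Z P enc dec"
  unfolding mean_square_stabilizes_def
  using measurable_policy_scheme closed_loop_scheme average_transmit_power_scheme mean_square_stable_scheme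
  by blast

end

section \<open>From Gaussian independence to uncorrelated noise\<close>

lemma (in prob_space) square_integrable_const: "square_integrable M (\<lambda>_. c)"
  by (simp add: square_integrable_def)

lemma (in prob_space) square_integrable_imp_integrable:
  "square_integrable M f \<Longrightarrow> integrable M f"
  using square_integrable_mult[OF _ square_integrable_const, of f 1] by simp

lemma (in prob_space) zero_mean_normal:
  assumes "distributed M lborel X (normal_density 0 \<sigma>)" "\<sigma> > 0"
  shows "square_integrable M X" "expectation X = 0" "mean_square M X = \<sigma>\<^sup>2"
proof -
  have "integrable lborel (\<lambda>x. normal_density 0 \<sigma> x * x\<^sup>2)"
    using integrable_normal_moment[OF assms(2), of 0 2] by simp
  then have "integrable M (\<lambda>\<omega>. (X \<omega>)\<^sup>2)"
    using distributed_integrable[OF assms(1), of "\<lambda>x. x\<^sup>2"] by simp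
  moreover have "X \<in> borel_measurable M"
    using distributed_measurable[OF assms(1)] by simp
  ultimately show "square_integrable M X"
    by (simp add: square_integrable_def)
  show "expectation X = 0"
    using assms by (intro normal_distributed_expectation)
  then show "mean_square M X = \<sigma>\<^sup>2"
    using normal_distributed_variance[OF assms(2,1)] by (simp add: mean_square_def)
qed

text \<open>One vanishing mean suffices for the product of expectations to vanish; in the
  applications it is that of the noise, so the initial state may have any mean.\<close>

lemma (in prob_space) indep_var_imp_uncorrelated:
  fixes f g :: "'a \<Rightarrow> real"
  assumes "indep_var borel f borel g" "square_integrable M f" "square_integrable M g" "expectation g = 0"
  shows "uncorrelated M f g"
  using assms indep_var_lebesgue_integral[OF assms(1) square_integrable_imp_integrable square_integrable_imp_integrable]
  by (simp add: uncorrelated_def)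

lemma sigma_sets_vimage_compose_subset:
  assumes X: "X \<in> measurable M MX" and \<phi>: "\<phi> \<in> measurable MX borel"
  shows "sigma_sets (space M) {(\<lambda>\<omega>. \<phi> (X \<omega>)) -` E \<inter> space M | E. E \<in> sets borel}
    \<subseteq> {X -` E \<inter> space M | E. E \<in> sets MX}"
proof -
  have "sigma_sets (space M) {(\<lambda>\<omega>. \<phi> (X \<omega>)) -` E \<inter> space M | E. E \<in> sets borel}
      = sets (vimage_algebra (space M) (\<lambda>\<omega>. \<phi> (X \<omega>)) borel)"
    using sets.sigma_sets_eq[of "vimage_algebra (space M) (\<lambda>\<omega>. \<phi> (X \<omega>)) borel"]
    by (simp add: sets_vimage_algebra2)
  also have "\<dots> \<subseteq> {X -` E \<inter> space M | E. E \<in> sets MX}"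
  proof
    fix F assume "F \<in> sets (vimage_algebra (space M) (\<lambda>\<omega>. \<phi> (X \<omega>)) borel)"
    then obtain E where E: "E \<in> sets borel" "F = (\<lambda>\<omega>. \<phi> (X \<omega>)) -` E \<inter> space M"
      by (auto simp: sets_vimage_algebra2)
    then have "F = X -` (\<phi> -` E \<inter> space MX) \<inter> space M" "\<phi> -` E \<inter> space MX \<in> sets MX"
      using measurable_space[OF X] measurable_sets[OF \<phi>] by auto
    then show "F \<in> {X -` E \<inter> space M | E. E \<in> sets MX}"
      by blast
  qed
  finally show ?thesis .
qed

text \<open>A function of X generates a smaller sigma-algebra than X. This extracts scalar pairs
  from the joint independence of the initial state and whole noise sequences.\<close>

lemma (in prob_space) independent_vars_compose:
  assumes "independent_vars M MX X MY Y" "\<phi> \<in> measurable MX borel" "\<psi> \<in> measurable MY borel"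
  shows "indep_var borel (\<lambda>\<omega>. \<phi> (X \<omega>)) borel (\<lambda>\<omega>. \<psi> (Y \<omega>))"
proof -
  have X: "X \<in> measurable M MX" and Y: "Y \<in> measurable M MY"
    and indep: "indep_set {X -` E \<inter> space M | E. E \<in> sets MX} {Y -` E \<inter> space M | E. E \<in> sets MY}"
    using assms(1) by (auto simp: independent_vars_def)
  show ?thesis
    unfolding indep_var_eq
  proof (intro conjI)
    show "indep_set (sigma_sets (space M) {(\<lambda>\<omega>. \<phi> (X \<omega>)) -` A \<inter> space M | A. A \<in> sets borel})
        (sigma_sets (space M) {(\<lambda>\<omega>. \<psi> (Y \<omega>)) -` A \<inter> space M | A. A \<in> sets borel})"
      using indep unfolding indep_set_def
      by (rule indep_sets_mono_sets)
        (simp add: sigma_sets_vimage_compose_subset[OF X assms(2)]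
          sigma_sets_vimage_compose_subset[OF Y assms(3)] split: bool.split)
  qed (use measurable_compose[OF X assms(2)] measurable_compose[OF Y assms(3)] in simp_all)
qed

lemma (in prob_space) indep_vars_imp_independent_vars:
  assumes "indep_vars M' X I" "s \<in> I" "t \<in> I" "s \<noteq> t"
  shows "independent_vars M (M' s) (X s) (M' t) (X t)"
proof -
  have X: "\<And>i. i \<in> I \<Longrightarrow> X i \<in> measurable M (M' i)"
    and indep: "indep_sets (\<lambda>i. {X i -` A \<inter> space M | A. A \<in> sets (M' i)}) I"
    using assms(1) unfolding indep_vars_def2 by auto
  have "prob (a \<inter> b) = prob a * prob b"
    if "a \<in> {X s -` A \<inter> space M | A. A \<in> sets (M' s)}" "b \<in> {X t -` A \<inter> space M | A. A \<in> sets (M' t)}" for a b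
    using indep_setsD[OF indep, of "{s, t}" "\<lambda>i. if i = s then a else b"] that assms(2-4)
    by (auto simp: Int_commute mult.commute)
  then show ?thesis
    unfolding independent_vars_def indep_sets2_eq using X assms(2,3) by (auto intro: measurable_sets)
qed

text \<open>Finite entropy provides a Lebesgue density, and a hyperplane is a null set; a vanishing
  second moment would put all the mass on the hyperplane orthogonal to a.\<close>

lemma (in prob_space) finite_differential_entropy_nondegenerate:
  fixes Y :: "'a \<Rightarrow> real^'n"
  assumes "finite_differential_entropy M Y" "square_integrable M (\<lambda>\<omega>. a \<bullet> Y \<omega>)" "a \<noteq> 0"
  shows "mean_square M (\<lambda>\<omega>. a \<bullet> Y \<omega>) > 0"
proof (rule ccontr)
  assume "\<not> ?thesis"
  then have "mean_square M (\<lambda>\<omega>. a \<bullet> Y \<omega>) = 0"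
    using mean_square_nonneg[of M "\<lambda>\<omega>. a \<bullet> Y \<omega>"] by simp
  then have AE: "AE \<omega> in M. a \<bullet> Y \<omega> = 0"
    using assms(2) integral_nonneg_eq_0_iff_AE[of M "\<lambda>\<omega>. (a \<bullet> Y \<omega>)\<^sup>2"]
    by (simp add: mean_square_def square_integrable_def)
  interpret information_space M 2
    by unfold_locales simp
  obtain p where "distributed M lborel Y p"
    using assms(1) finite_entropy_distributed unfolding finite_differential_entropy_def by blast
  define H where "H = {x. a \<bullet> x = 0}"
  have "H \<in> sets borel"
    unfolding H_def by (intro borel_closed closed_hyperplane)
  moreover have "H \<in> null_sets lebesgue"
    using negligible_hyperplane[of a 0] assms(3) by (simp add: H_def negligible_iff_null_sets)
  ultimately have "H \<in> null_sets lborel"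
    by (simp add: null_sets_completion_iff)
  have "emeasure M (Y -` H \<inter> space M) = (\<integral>\<^sup>+x. p x * indicator H x \<partial>lborel)"
    using \<open>distributed M lborel Y p\<close> \<open>H \<in> sets borel\<close> by (simp add: distributed_emeasure)
  also have "\<dots> = 0"
    using \<open>H \<in> null_sets lborel\<close> by (intro nn_integral_null_set)
  finally have "AE \<omega> in M. \<not> a \<bullet> Y \<omega> = 0"
    using \<open>H \<in> sets borel\<close> distributed_measurable[OF \<open>distributed M lborel Y p\<close>]
    by (intro AE_I[of _ _ "Y -` H \<inter> space M"]) (auto simp: H_def)
  with AE have "AE \<omega> in M. False"
    by eventually_elim simp
  then show False
    by simp
qed

lemma (in prob_space) uncorrelated_noise_intro:
  fixes X0 :: "'a \<Rightarrow> real^'n"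
  assumes "finite_differential_entropy M X0" "has_covariance M X0 \<Lambda>" "white_gaussian_vectors M W K"
    "N > 0" "white_gaussian_scalars M Z N"
    and X0_W: "independent_vars M borel X0 (\<Pi>\<^sub>M t\<in>UNIV. borel) (\<lambda>\<omega> t. W t \<omega>)"
    and X0W_Z: "independent_vars M (borel \<Otimes>\<^sub>M (\<Pi>\<^sub>M t\<in>UNIV. borel)) (\<lambda>\<omega>. (X0 \<omega>, \<lambda>t. W t \<omega>))
           (\<Pi>\<^sub>M t\<in>UNIV. borel) (\<lambda>\<omega> t. Z t \<omega>)"
  shows "uncorrelated_noise M X0 W Z N"
proof -
  have X0: "square_integrable M (\<lambda>\<omega>. a \<bullet> X0 \<omega>)" for a
  proof -
    have meas: "X0 \<in> borel_measurable M" and int: "integrable M (\<lambda>\<omega>. (norm (X0 \<omega>))\<^sup>2)"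
      using assms(2) by (auto simp: has_covariance_def)
    have "integrable M (\<lambda>\<omega>. (a \<bullet> X0 \<omega>)\<^sup>2)"
    proof (rule Bochner_Integration.integrable_bound)
      show "integrable M (\<lambda>\<omega>. (norm a)\<^sup>2 * (norm (X0 \<omega>))\<^sup>2)"
        using int by simp
      have "(a \<bullet> x)\<^sup>2 \<le> (norm a)\<^sup>2 * (norm x)\<^sup>2" for x
        using power_mono[OF Cauchy_Schwarz_ineq2[of a x], of 2] by (simp add: power_mult_distrib)
      then show "AE \<omega> in M. norm ((a \<bullet> X0 \<omega>)\<^sup>2) \<le> norm ((norm a)\<^sup>2 * (norm (X0 \<omega>))\<^sup>2)"
        by simp
    qed (use meas in measurable)
    then show ?thesis
      using meas by (simp add: square_integrable_def)
  qed
  have W: "square_integrable M (\<lambda>\<omega>. a \<bullet> W t \<omega>) \<and> expectation (\<lambda>\<omega>. a \<bullet> W t \<omega>) = 0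
      \<and> mean_square M (\<lambda>\<omega>. a \<bullet> W t \<omega>) = a \<bullet> (K *v a)" for a t
  proof -
    have "zero_mean_gaussian M (W t) K"
      using assms(3) by (simp add: white_gaussian_vectors_def)
    then have meas: "W t \<in> borel_measurable M" and pos: "0 \<le> a \<bullet> (K *v a)"
      and dist: "if a \<bullet> (K *v a) = 0 then (AE \<omega> in M. a \<bullet> W t \<omega> = 0)
          else distributed M lborel (\<lambda>\<omega>. a \<bullet> W t \<omega>) (normal_density 0 (sqrt (a \<bullet> (K *v a))))"
      by (auto simp: zero_mean_gaussian_def)
    show ?thesis
    proof (cases "a \<bullet> (K *v a) = 0")
      \<comment> \<open>A singular covariance: the functional is almost surely 0 and has no normal
        density, but the same three moment identities hold.\<close>
      case True
      then have AE: "AE \<omega> in M. a \<bullet> W t \<omega> = 0"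
        using dist by simp
      then have AE2: "AE \<omega> in M. (a \<bullet> W t \<omega>)\<^sup>2 = 0"
        by eventually_elim simp
      have "integrable M (\<lambda>\<omega>. (a \<bullet> W t \<omega>)\<^sup>2) \<longleftrightarrow> integrable M (\<lambda>_. 0 :: real)"
        using meas AE2 by (intro integrable_cong_AE) auto
      then have "square_integrable M (\<lambda>\<omega>. a \<bullet> W t \<omega>)"
        using meas by (simp add: square_integrable_def)
      moreover have "expectation (\<lambda>\<omega>. a \<bullet> W t \<omega>) = 0" "mean_square M (\<lambda>\<omega>. a \<bullet> W t \<omega>) = 0"
        using integral_eq_zero_AE[OF AE] integral_eq_zero_AE[OF AE2] by (simp_all add: mean_square_def)
      ultimately show ?thesis
        using True by simp
    next
      case False
      then have "distributed M lborel (\<lambda>\<omega>. a \<bullet> W t \<omega>) (normal_density 0 (sqrt (a \<bullet> (K *v a))))"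
        and "sqrt (a \<bullet> (K *v a)) > 0"
        using dist pos by auto
      from zero_mean_normal[OF this] show ?thesis
        using pos by simp
    qed
  qed
  have Z: "square_integrable M (Z t)" "expectation (Z t) = 0" "mean_square M (Z t) = N" for t
    using zero_mean_normal[of "Z t" "sqrt N"] assms(4,5) by (auto simp: white_gaussian_scalars_def)
  have component: "(\<lambda>w. w t) \<in> measurable (\<Pi>\<^sub>M t\<in>UNIV. borel) borel" for t :: nat
    by (rule measurable_component_singleton) simp
  have inner: "(\<lambda>x. a \<bullet> x) \<in> borel_measurable borel" for a :: "real^'n"
    by measurable
  show ?thesis
  proof
    show "uncorrelated M (\<lambda>\<omega>. a \<bullet> X0 \<omega>) (Z t)" for a t
      by (intro indep_var_imp_uncorrelated X0 Z
          independent_vars_compose[OF X0W_Z measurable_compose[OF measurable_fst inner] component, simplified])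
    show "uncorrelated M (\<lambda>\<omega>. a \<bullet> W s \<omega>) (Z t)" for a s t
      by (intro indep_var_imp_uncorrelated W[THEN conjunct1] Z independent_vars_compose[OF X0W_Z
          measurable_compose[OF measurable_compose[OF measurable_snd component] inner] component, simplified])
    show "uncorrelated M (\<lambda>\<omega>. a \<bullet> X0 \<omega>) (\<lambda>\<omega>. b \<bullet> W t \<omega>)" for a b t
      using W by (intro indep_var_imp_uncorrelated X0
          independent_vars_compose[OF X0_W inner measurable_compose[OF component inner]]) auto
    show "uncorrelated M (\<lambda>\<omega>. a \<bullet> W s \<omega>) (\<lambda>\<omega>. b \<bullet> W t \<omega>)" if "s \<noteq> t" for a b s t
    proof -
      have "independent_vars M borel (W s) borel (W t)"
        using assms(3) that indep_vars_imp_independent_vars[of "\<lambda>_. borel" W UNIV s t]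
        by (simp add: white_gaussian_vectors_def)
      then show ?thesis
        using W by (intro indep_var_imp_uncorrelated independent_vars_compose[OF _ inner inner]) auto
    qed
    show "uncorrelated M (Z s) (Z t)" if "s \<noteq> t" for s t
    proof -
      have "independent_vars M borel (Z s) borel (Z t)"
        using assms(5) that indep_vars_imp_independent_vars[of "\<lambda>_. borel" Z UNIV s t]
        by (simp add: white_gaussian_scalars_def)
      then show ?thesis
        using Z independent_vars_compose[OF _ measurable_ident measurable_ident]
        by (intro indep_var_imp_uncorrelated) (auto simp: id_def)
    qed
    show "mean_square M (\<lambda>\<omega>. a \<bullet> W t \<omega>) = mean_square M (\<lambda>\<omega>. a \<bullet> W 0 \<omega>)" for a t
      using W by simp
    show "mean_square M (\<lambda>\<omega>. a \<bullet> X0 \<omega>) > 0" if "a \<noteq> 0" for a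
      using finite_differential_entropy_nondegenerate[OF assms(1) X0 that] .
  qed (rule Z)
qed

theorem theorem6p1:
  fixes M :: "'w measure"
    and A :: "real^'n^'n" and B :: "real^'m^'n"
    and X0 :: "'w \<Rightarrow> real^'n" and W :: "nat \<Rightarrow> 'w \<Rightarrow> real^'n" and Z :: "nat \<Rightarrow> 'w \<Rightarrow> real"
    and \<Lambda>0 K\<^sub>W :: "real^'n^'n" and P N :: real
  assumes "prob_space M"
    and "controllable A B"
    and "\<And>\<mu>. eigenvalue A \<mu> \<Longrightarrow> cmod \<mu> \<ge> 1"
    and "finite_differential_entropy M X0" and "has_covariance M X0 \<Lambda>0"
    and "white_gaussian_vectors M W K\<^sub>W"
    and "P \<ge> 0" and "N > 0" and "white_gaussian_scalars M Z N"
    and "independent_vars M borel X0 (\<Pi>\<^sub>M t\<in>UNIV. borel) (\<lambda>\<omega> t. W t \<omega>)"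
    and "independent_vars M (borel \<Otimes>\<^sub>M (\<Pi>\<^sub>M t\<in>UNIV. borel)) (\<lambda>\<omega>. (X0 \<omega>, \<lambda>t. W t \<omega>))
           (\<Pi>\<^sub>M t\<in>UNIV. borel) (\<lambda>\<omega> t. Z t \<omega>)"
    and "log 2 \<bar>det A\<bar> < information_capacity P N"
  shows "\<exists>f g. mean_square_stabilizes M A B X0 W Z P f g \<and>
               linear_policy f g \<and> sequential_scalar_encoding f"
proof -
  interpret prob_space M
    by fact
  have det: "\<bar>det A\<bar> \<ge> 1"
    using assms(3) by (rule abs_det_ge_1)
  then have "0 < information_capacity P N"
    using assms(12) by (simp add: le_less_trans[of 0 "log 2 \<bar>det A\<bar>"])
  \<comment> \<open>At P = 0 the capacity is 0, which the strict inequality with log |det A|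
    nonnegative excludes.\<close>
  then have "P > 0"
    using \<open>P \<ge> 0\<close> by (cases "P = 0") (auto simp: information_capacity_def)
  have "log 2 ((det A)\<^sup>2) = 2 * log 2 \<bar>det A\<bar>"
    using log_nat_power[of "\<bar>det A\<bar>" 2 2] det by simp
  also have "\<dots> < log 2 (1 + P / N)"
    using assms(12) by (simp add: information_capacity_def)
  finally have "(det A)\<^sup>2 < 1 + P / N"
    using det \<open>P > 0\<close> \<open>N > 0\<close> by (subst (asm) log_less_cancel_iff) (auto simp: add_pos_pos)
  then have "(det A)\<^sup>2 * (N / (P + N)) < 1" "0 < N / (P + N)" "N / (P + N) < 1"
    using \<open>P > 0\<close> \<open>N > 0\<close> by (simp_all add: field_simps)
  then obtain L and v :: "'n \<Rightarrow> real^'n" and sch where scheme: "CARD('n) \<le> L"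
    "\<And>i j. v i \<bullet> v j = (if i = j then 1 else 0)"
    "\<And>i j. i \<noteq> j \<Longrightarrow> ((*v) A ^^ L) (v i) \<bullet> ((*v) A ^^ L) (v j) = 0"
    "\<And>i. (norm (((*v) A ^^ L) (v i)))\<^sup>2 * (N / (P + N)) ^ card {s. s < L - CARD('n) \<and> sch s = i} \<le> 1 / 2"
    using contracting_schedule[of A "N / (P + N)", OF assms(3)] by blast
  obtain ctl :: "nat \<Rightarrow> real^'n \<Rightarrow> real^'m" where ctl: "\<And>j. linear (ctl j)"
    "\<And>z. (\<Sum>j<CARD('n). ((*v) A ^^ j) (B *v ctl j z)) = z"
    using deadbeat_controls[OF assms(2)] by blast
  have G_inj: "x = 0" if "((*v) A ^^ L) x = 0" for x
  proof -
    obtain K where "\<And>t x. norm x \<le> K * (1 + 1) ^ t * norm (((*v) A ^^ t) x)"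
      using expanding_power_lower_bound[OF assms(3) zero_less_one] by blast
    from this[of x L] that show ?thesis
      by simp
  qed
  interpret uncorrelated_noise M X0 W Z N
    by (rule uncorrelated_noise_intro[OF assms(4,5,6,8,9,10,11)])
  \<comment> \<open>Any input coordinate may carry the copies, so \<open>undefined\<close> serves as
    \<open>j0\<close>; the number of transmitting slots is what n steering slots leave of
    \<open>L\<close>.\<close>
  interpret periodic_scheme M X0 W Z N A B P L "L - CARD('n)" v sch ctl undefined
    by (rule periodic_scheme.intro[OF uncorrelated_noise_axioms
          periodic_scheme_axioms.intro[OF \<open>P > 0\<close> \<open>N > 0\<close> _ scheme(2-4) G_inj ctl]])
      (use scheme(1) in simp_all)
  show ?thesis
    using mean_square_stabilizes_scheme linear_policy_scheme sequential_scalar_encoding_scheme by blast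
qed

end
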